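(* Let $\{(X_i,x_i)\}_{i\in\mathbb{N}}$ be a family of pointed spaces, each locally strongly contractible at $x_i$ and first countable at $x_i$. Let $X=\widetilde{\bigvee}_{i\in\mathbb{N}}(X_i,x_i)$ be their weak join with common point $x_\ast$, and $n\geq1$. Then $\mathcal{H}_n(X,x_\ast)\cong L_n(X,x_\ast)$.
   Context: A pointed space $(Y,y_0)$ is locally strongly contractible at $y_0$ if for every neighborhood $U$ of $y_0$ there is a neighborhood $V\subseteq U$ of $y_0$ such that the inclusion $V\hookrightarrow U$ is homotopic in $U$ to the constant map at $y_0$ relative to $\{y_0\}$. The weak join $\widetilde{\bigvee}_{i\in\mathbb{N}}(X_i,x_i)$ is the set obtained from the disjoint union of the $X_i$ by identifying all $x_i$ to one point $x_\ast$, with the topology in which $U$ is open iff $U\cap X_i$ is open in $X_i$ for each $i$ and, whenever $x_\ast\in U$, $X_i\subseteq U$ for all but finitely many $i$. For $n\geq1$, the $n$-dimensional Hawaiian earring is $\mathbb{H}^n=\{(r_0,\dots,r_n)\in\mathbb{R}^{n+1} : (r_0-1/k)^2+\sum_{i=1}^n r_i^2=(1/k)^2 \text{ for some } k\in\mathbb{N}\}$ with base point $\theta=(0,\dots,0)$; $S^n_k$ denotes the $n$-sphere of radius $1/k$ in it. The $n$-Hawaiian group $\mathcal{H}_n(X,x_\ast)$ is the set of pointed homotopy classes (rel $\{\theta\}$) of continuous maps $(\mathbb{H}^n,\theta)\to(X,x_\ast)$, with group operation $[f][g]=[f\ast g]$, where $(f\ast g)|_{S^n_k}$ is the usual concatenation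 (as in $\pi_n$) of $f|_{S^n_k}$ and $g|_{S^n_k}$. A family of maps $\{f_i\}$ into $(X,x_\ast)$ is null-convergent if for each open $U\ni x_\ast$, $\operatorname{Im}(f_i)\subseteq U$ for all but finitely many $i$. $L_n(X,x_\ast)$ is the subgroup of $\prod_{i\in\mathbb{N}}\pi_n(X,x_\ast)$ of all sequences $([f_i])_i$ having representatives forming a null-convergent family. *)

theory Defs
  imports "HOL-Analysis.Analysis" "HOL-Algebra.Group"
begin

definition nbhd :: "'b topology \<Rightarrow> 'b \<Rightarrow> 'b set \<Rightarrow> bool" where
  "nbhd Y y U \<longleftrightarrow> U \<subseteq> topspace Y \<and> (\<exists>W. openin Y W \<and> y \<in> W \<and> W \<subseteq> U)"

definition loc_strongly_contractible :: "'b topology \<Rightarrow> 'b \<Rightarrow> bool" where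
  "loc_strongly_contractible Y y0 \<longleftrightarrow>
     (\<forall>U. nbhd Y y0 U \<longrightarrow>
        (\<exists>V. nbhd Y y0 V \<and> V \<subseteq> U \<and>
             homotopic_with (\<lambda>h. h y0 = y0) (subtopology Y V) (subtopology Y U) id (\<lambda>_. y0)))"

definition first_countable_at :: "'b topology \<Rightarrow> 'b \<Rightarrow> bool" where
  "first_countable_at Y y \<longleftrightarrow>
     (\<exists>B. countable B \<and> (\<forall>W\<in>B. openin Y W \<and> y \<in> W) \<and>
          (\<forall>U. openin Y U \<and> y \<in> U \<longrightarrow> (\<exists>W\<in>B. W \<subseteq> U)))"

text \<open>Points of the weak join: None is the common point x_*, Some (i,y) is a point y \<noteq> x_i of X_i.\<close>
definition wj_in :: "(nat \<Rightarrow> 'a) \<Rightarrow> nat \<Rightarrow> 'a \<Rightarrow> (nat \<times> 'a) option" where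
  "wj_in x i y = (if y = x i then None else Some (i, y))"

definition wj_carrier :: "(nat \<Rightarrow> 'a topology) \<Rightarrow> (nat \<Rightarrow> 'a) \<Rightarrow> (nat \<times> 'a) option set" where
  "wj_carrier X x = insert None (\<Union>i. wj_in x i ` topspace (X i))"

definition weak_join :: "(nat \<Rightarrow> 'a topology) \<Rightarrow> (nat \<Rightarrow> 'a) \<Rightarrow> (nat \<times> 'a) option topology" where
  "weak_join X x = topology (\<lambda>U.
      U \<subseteq> wj_carrier X x \<and>
      (\<forall>i. openin (X i) {y \<in> topspace (X i). wj_in x i y \<in> U}) \<and>
      (None \<in> U \<longrightarrow> finite {i. \<not> (wj_in x i ` topspace (X i) \<subseteq> U)}))"


lemma istopology_weak_join:
  "istopology (\<lambda>U. U \<subseteq> wj_carrier X x \<and>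
      (\<forall>i. openin (X i) {y \<in> topspace (X i). wj_in x i y \<in> U}) \<and>
      (None \<in> U \<longrightarrow> finite {i. \<not> (wj_in x i ` topspace (X i) \<subseteq> U)}))"
  unfolding istopology_def
proof (intro conjI allI impI ballI)
  fix S T assume S: "S \<subseteq> wj_carrier X x \<and> (\<forall>i. openin (X i) {y \<in> topspace (X i). wj_in x i y \<in> S}) \<and>
      (None \<in> S \<longrightarrow> finite {i. \<not> (wj_in x i ` topspace (X i) \<subseteq> S)})"
    and T: "T \<subseteq> wj_carrier X x \<and> (\<forall>i. openin (X i) {y \<in> topspace (X i). wj_in x i y \<in> T}) \<and>
      (None \<in> T \<longrightarrow> finite {i. \<not> (wj_in x i ` topspace (X i) \<subseteq> T)})"
  show "S \<inter> T \<subseteq> wj_carrier X x" using S by blast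
  show "openin (X i) {y \<in> topspace (X i). wj_in x i y \<in> S \<inter> T}" for i
  proof -
    have "{y \<in> topspace (X i). wj_in x i y \<in> S \<inter> T} = {y \<in> topspace (X i). wj_in x i y \<in> S} \<inter> {y \<in> topspace (X i). wj_in x i y \<in> T}" by blast
    then show ?thesis using S T by (simp add: openin_Int)
  qed
  show "finite {i. \<not> wj_in x i ` topspace (X i) \<subseteq> S \<inter> T}" if "None \<in> S \<inter> T"
  proof -
    from that have "finite ({i. \<not> wj_in x i ` topspace (X i) \<subseteq> S} \<union> {i. \<not> wj_in x i ` topspace (X i) \<subseteq> T})" using S T by auto
    moreover have "{i. \<not> wj_in x i ` topspace (X i) \<subseteq> S \<inter> T} \<subseteq> {i. \<not> wj_in x i ` topspace (X i) \<subseteq> S} \<union> {i. \<not> wj_in x i ` topspace (X i) \<subseteq> T}" by blast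
    ultimately show "finite {i. \<not> wj_in x i ` topspace (X i) \<subseteq> S \<inter> T}" using finite_subset by blast
  qed
next
  fix K assume K: "\<forall>U\<in>K. U \<subseteq> wj_carrier X x \<and> (\<forall>i. openin (X i) {y \<in> topspace (X i). wj_in x i y \<in> U}) \<and>
      (None \<in> U \<longrightarrow> finite {i. \<not> (wj_in x i ` topspace (X i) \<subseteq> U)})"
  show "\<Union>K \<subseteq> wj_carrier X x" using K by blast
  show "openin (X i) {y \<in> topspace (X i). wj_in x i y \<in> \<Union>K}" for i
  proof -
    have "{y \<in> topspace (X i). wj_in x i y \<in> \<Union>K} = (\<Union>U\<in>K. {y \<in> topspace (X i). wj_in x i y \<in> U})" by blast
    then show ?thesis using K by (auto intro!: openin_Union)
  qed
  show "finite {i. \<not> wj_in x i ` topspace (X i) \<subseteq> \<Union>K}" if "None \<in> \<Union>K"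
  proof -
    from that obtain U where U: "U \<in> K" "None \<in> U" by blast
    then have "finite {i. \<not> wj_in x i ` topspace (X i) \<subseteq> U}" using K by blast
    moreover have "{i. \<not> wj_in x i ` topspace (X i) \<subseteq> \<Union>K} \<subseteq> {i. \<not> wj_in x i ` topspace (X i) \<subseteq> U}" using U by blast
    ultimately show "finite {i. \<not> wj_in x i ` topspace (X i) \<subseteq> \<Union>K}" using finite_subset by blast
  qed
qed

definition cube_bd :: "(real^'n) set" where
  "cube_bd = cbox 0 1 - box 0 1"

definition pi_maps :: "'b topology \<Rightarrow> 'b \<Rightarrow> (real^'n::finite \<Rightarrow> 'b) set" where
  "pi_maps Y y = {f. continuous_map (top_of_set (cbox 0 1)) Y f \<and> (\<forall>t\<in>cube_bd. f t = y)}"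

definition pi_class :: "'b topology \<Rightarrow> 'b \<Rightarrow> (real^'n::finite \<Rightarrow> 'b) \<Rightarrow> (real^'n \<Rightarrow> 'b) set" where
  "pi_class Y y f = {g \<in> pi_maps Y y.
      homotopic_with (\<lambda>h. \<forall>t\<in>cube_bd. h t = y) (top_of_set (cbox 0 1)) Y f g}"

text \<open>Fixed coordinate in which cube maps are concatenated.\<close>
definition c0 :: "'n" where "c0 = (SOME i. True)"

definition cube_concat :: "(real^'n::finite \<Rightarrow> 'b) \<Rightarrow> (real^'n \<Rightarrow> 'b) \<Rightarrow> real^'n \<Rightarrow> 'b" where
  "cube_concat f g = (\<lambda>t. if t$c0 \<le> 1/2
       then f (\<chi> i. if i = c0 then 2 * t$c0 else t$i)
       else g (\<chi> i. if i = c0 then 2 * t$c0 - 1 else t$i))"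

text \<open>pi_n(Y,y), n = CARD('n).\<close>
definition homotopy_group :: "'b topology \<Rightarrow> 'b \<Rightarrow> ((real^'n::finite \<Rightarrow> 'b) set) monoid" where
  "homotopy_group Y y =
     \<lparr>carrier = pi_class Y y ` pi_maps Y y,
      mult = (\<lambda>A B. pi_class Y y (cube_concat (SOME f. f \<in> A) (SOME g. g \<in> B))),
      one = pi_class Y y (\<lambda>_. y)\<rparr>"

text \<open>Points of R^(n+1) are real^('n option); coordinate None is r_0.\<close>
definition hsphere :: "nat \<Rightarrow> (real^('n::finite option)) set" where
  "hsphere k = {r. (r$None - 1 / real k)^2 + (\<Sum>i\<in>UNIV. (r$(Some i))^2) = (1 / real k)^2}"

definition hawaiian :: "(real^('n::finite option)) set" where
  "hawaiian = (\<Union>k\<in>{1..}. hsphere k)"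

text \<open>Standard identification of I^n / boundary with the unit n-sphere, boundary going to -e_0.\<close>
definition cube_to_sphere :: "real^'n::finite \<Rightarrow> real^('n option)" where
  "cube_to_sphere t = (let u = 2 *\<^sub>R t - 1 in
     (\<chi> j. case j of None \<Rightarrow> cos (pi * infnorm u)
                   | Some i \<Rightarrow> sin (pi * infnorm u) * u$i / norm u))"

definition sk_param :: "nat \<Rightarrow> real^'n::finite \<Rightarrow> real^('n option)" where
  "sk_param k t = (1 / real k) *\<^sub>R (axis None 1 + cube_to_sphere t)"

definition hw_concat :: "'b \<Rightarrow> (real^('n::finite option) \<Rightarrow> 'b) \<Rightarrow> (real^('n option) \<Rightarrow> 'b) \<Rightarrow> real^('n option) \<Rightarrow> 'b" where
  "hw_concat y f g = (\<lambda>p. if p \<in> hawaiian - {0} then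
       (let k = (SOME k. 1 \<le> k \<and> p \<in> hsphere k);
            t = (SOME t::real^'n. t \<in> box 0 1 \<and> sk_param k t = p)
        in cube_concat (f \<circ> sk_param k) (g \<circ> sk_param k) t)
     else y)"

definition hw_maps :: "'b topology \<Rightarrow> 'b \<Rightarrow> (real^('n::finite option) \<Rightarrow> 'b) set" where
  "hw_maps Y y = {f. continuous_map (top_of_set hawaiian) Y f \<and> f 0 = y}"

definition hw_class :: "'b topology \<Rightarrow> 'b \<Rightarrow> (real^('n::finite option) \<Rightarrow> 'b) \<Rightarrow> (real^('n option) \<Rightarrow> 'b) set" where
  "hw_class Y y f = {g \<in> hw_maps Y y.
      homotopic_with (\<lambda>h. h 0 = y) (top_of_set hawaiian) Y f g}"

text \<open>The n-Hawaiian group, n = CARD('n).\<close>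
definition hawaiian_group :: "'b topology \<Rightarrow> 'b \<Rightarrow> ((real^('n::finite option) \<Rightarrow> 'b) set) monoid" where
  "hawaiian_group Y y =
     \<lparr>carrier = hw_class Y y ` hw_maps Y y,
      mult = (\<lambda>A B. hw_class Y y (hw_concat y (SOME f. f \<in> A) (SOME g. g \<in> B))),
      one = hw_class Y y (\<lambda>_. y)\<rparr>"

definition null_convergent :: "'b topology \<Rightarrow> 'b \<Rightarrow> (nat \<Rightarrow> real^'n::finite \<Rightarrow> 'b) \<Rightarrow> bool" where
  "null_convergent Y y f \<longleftrightarrow>
     (\<forall>U. openin Y U \<and> y \<in> U \<longrightarrow> (\<forall>\<^sub>F i in sequentially. f i ` cbox 0 1 \<subseteq> U))"

definition L_group :: "'b topology \<Rightarrow> 'b \<Rightarrow> (nat \<Rightarrow> (real^'n::finite \<Rightarrow> 'b) set) monoid" where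
  "L_group Y y =
     \<lparr>carrier = {s. (\<forall>i. s i \<in> carrier (homotopy_group Y y)) \<and>
                   (\<exists>f. (\<forall>i. f i \<in> s i) \<and> null_convergent Y y f)},
      mult = (\<lambda>s r i. s i \<otimes>\<^bsub>homotopy_group Y y\<^esub> r i),
      one = (\<lambda>i. \<one>\<^bsub>homotopy_group Y y\<^esub>)\<rparr>"

end

theory Submission
  imports Defs
begin

text \<open>Restricting a map on the earring to its spheres sends the class of \<open>f\<close> to the sequence of classes
  of the restrictions \<open>f\<^sub>k\<close>, and null-convergent families of cube maps glue to maps on the earring. So the
  only issue is injectivity: given homotopies between \<open>f\<^sub>k\<close> and \<open>g\<^sub>k\<close> for every \<open>k\<close>, one needs
  null-convergent ones. First countability gives a sequence of neighbourhoods \<open>W m\<close> of the common point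
  shrinking to it, where \<open>W m\<close> contains all of \<open>X i\<close> for \<open>i \<ge> m\<close>. By strong contractibility, the
  retraction \<open>r m\<close> that collapses \<open>X i\<close> for \<open>i < m\<close> is, on a smaller neighbourhood \<open>V m\<close>, homotopic to
  the inclusion within \<open>W m\<close>. Hence if \<open>f\<^sub>k\<close> and \<open>g\<^sub>k\<close> lie in \<open>V m\<close>, an arbitrary homotopy \<open>H\<close> can be
  replaced by one in \<open>W m\<close>, namely the composite of \<open>f\<^sub>k \<simeq> r m \<circ> f\<^sub>k\<close>, \<open>r m \<circ> H\<close> and
  \<open>r m \<circ> g\<^sub>k \<simeq> g\<^sub>k\<close>.\<close>

section \<open>The weak join\<close>

lemma openin_weak_join:
  "openin (weak_join X x) U \<longleftrightarrow>
     U \<subseteq> wj_carrier X x \<and>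
     (\<forall>i. openin (X i) {y \<in> topspace (X i). wj_in x i y \<in> U}) \<and>
     (None \<in> U \<longrightarrow> finite {i. \<not> (wj_in x i ` topspace (X i) \<subseteq> U)})"
  unfolding weak_join_def by (simp add: topology_inverse'[OF istopology_weak_join])

lemma wj_in_base [simp]: "wj_in x i (x i) = None"
  by (simp add: wj_in_def)

lemma wj_in_eq_iff: "wj_in x i y = wj_in x j z \<longleftrightarrow> i = j \<and> y = z \<or> y = x i \<and> z = x j"
  by (auto simp: wj_in_def)

lemma wj_in_carrier: "y \<in> topspace (X i) \<Longrightarrow> wj_in x i y \<in> wj_carrier X x"
  by (auto simp: wj_carrier_def)

lemma topspace_weak_join [simp]: "topspace (weak_join X x) = wj_carrier X x"
proof
  show "topspace (weak_join X x) \<subseteq> wj_carrier X x"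
    using openin_topspace openin_weak_join by blast
  have "openin (weak_join X x) (wj_carrier X x)"
    unfolding openin_weak_join
  proof (intro conjI allI impI)
    fix i
    have "{y \<in> topspace (X i). wj_in x i y \<in> wj_carrier X x} = topspace (X i)"
      using wj_in_carrier by fastforce
    then show "openin (X i) {y \<in> topspace (X i). wj_in x i y \<in> wj_carrier X x}" by simp
  next
    have "{i. \<not> wj_in x i ` topspace (X i) \<subseteq> wj_carrier X x} = {}"
      using wj_in_carrier by fastforce
    then show "finite {i. \<not> wj_in x i ` topspace (X i) \<subseteq> wj_carrier X x}" by simp
  qed simp
  then show "wj_carrier X x \<subseteq> topspace (weak_join X x)" by (rule openin_subset)
qed

text \<open>The standard neighbourhoods of the common point. Every \<open>D j\<close> contains
  \<open>x j\<close>, so the identification adds nothing to the trace on \<open>X i\<close>, which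
  is \<open>D i\<close> again.\<close>

lemma openin_weak_join_Union:
  assumes D: "\<And>j. openin (X j) (D j)" "\<And>j. x j \<in> D j"
    and fin: "finite {j. D j \<noteq> topspace (X j)}"
  shows "openin (weak_join X x) (\<Union>j. wj_in x j ` D j)"
  unfolding openin_weak_join
proof (intro conjI allI impI)
  have sub: "D j \<subseteq> topspace (X j)" for j by (rule openin_subset[OF D(1)])
  then show "(\<Union>j. wj_in x j ` D j) \<subseteq> wj_carrier X x"
    by (fastforce simp: wj_carrier_def)
  fix i
  have "{y \<in> topspace (X i). wj_in x i y \<in> (\<Union>j. wj_in x j ` D j)} = D i"
    using sub D(2) by (auto simp: wj_in_eq_iff)
  then show "openin (X i) {y \<in> topspace (X i). wj_in x i y \<in> (\<Union>j. wj_in x j ` D j)}"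
    using D(1) by simp
next
  have "{i. \<not> wj_in x i ` topspace (X i) \<subseteq> (\<Union>j. wj_in x j ` D j)} \<subseteq> {j. D j \<noteq> topspace (X j)}"
    by auto
  then show "finite {i. \<not> wj_in x i ` topspace (X i) \<subseteq> (\<Union>j. wj_in x j ` D j)}"
    using fin finite_subset by blast
qed

text \<open>Since \<open>S\<close> misses the base point, the image misses the common point and the
  finiteness condition is vacuous; the trace on every other \<open>X i\<close> is empty.\<close>

lemma openin_weak_join_image:
  assumes "openin (X j) S" "x j \<notin> S"
  shows "openin (weak_join X x) (wj_in x j ` S)"
  unfolding openin_weak_join
proof (intro conjI allI impI)
  have sub: "S \<subseteq> topspace (X j)" by (rule openin_subset[OF assms(1)])
  then show "wj_in x j ` S \<subseteq> wj_carrier X x"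
    by (fastforce simp: wj_carrier_def)
  fix i
  have "{y \<in> topspace (X i). wj_in x i y \<in> wj_in x j ` S} = (if i = j then S else {})"
    using sub assms(2) by (auto simp: wj_in_eq_iff)
  then show "openin (X i) {y \<in> topspace (X i). wj_in x i y \<in> wj_in x j ` S}"
    using assms(1) by simp
next
  assume "None \<in> wj_in x j ` S"
  then show "finite {i. \<not> wj_in x i ` topspace (X i) \<subseteq> wj_in x j ` S}"
    using assms(2) by (auto simp: wj_in_def split: if_splits)
qed

lemma continuous_map_wj_in: "continuous_map (X i) (weak_join X x) (wj_in x i)"
  unfolding continuous_map_def
  using wj_in_carrier by (fastforce simp: openin_weak_join)

text \<open>Points other than the common one need not be separated from it, since the \<open>X j\<close> need not be
  \<open>T\<^sub>1\<close>. This is why the proof distinguishes whether an open set contains the common value \<open>c\<close>.\<close>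

lemma continuous_map_weak_join_parametric:
  assumes D: "\<And>j. openin (X j) (D j)" "\<And>j. x j \<in> D j" "finite {j. D j \<noteq> topspace (X j)}"
    and k: "\<And>j. continuous_map (prod_topology T (subtopology (X j) (D j))) Z (k j)"
    and c: "\<And>j t. t \<in> topspace T \<Longrightarrow> k j (t, x j) = c"
    and fin: "\<And>S. openin Z S \<Longrightarrow> c \<in> S \<Longrightarrow> finite {j. \<not> k j ` (topspace T \<times> D j) \<subseteq> S}"
    and K: "\<And>t j z. t \<in> topspace T \<Longrightarrow> z \<in> D j \<Longrightarrow> K (t, wj_in x j z) = k j (t, z)"
  shows "continuous_map (prod_topology T (subtopology (weak_join X x) (\<Union>j. wj_in x j ` D j))) Z K"
proof -
  let ?V = "\<Union>j. wj_in x j ` D j" and ?Y = "weak_join X x"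
  have V: "openin ?Y ?V" using D by (rule openin_weak_join_Union)
  have sub: "D j \<subseteq> topspace (X j)" for j by (rule openin_subset[OF D(1)])
  have top: "topspace (prod_topology T (subtopology ?Y ?V)) = topspace T \<times> ?V"
    using openin_subset[OF V] by (auto simp: topspace_prod_topology)
  have topk: "topspace (prod_topology T (subtopology (X j) (D j))) = topspace T \<times> D j" for j
    using sub[of j] by (auto simp: topspace_prod_topology)
  \<comment> \<open>Continuity of \<open>k j\<close> at \<open>(t, z)\<close> yields an open box.
    Its second factor is open in \<open>X j\<close> itself because \<open>D j\<close> is
    open.\<close>
  have box: "\<exists>A B. openin T A \<and> openin (X j) B \<and> t \<in> A \<and> z \<in> B \<and> B \<subseteq> D j \<and>
               (\<forall>u\<in>A. \<forall>w\<in>B. K (u, wj_in x j w) \<in> S)"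
    if S: "openin Z S" and t: "t \<in> topspace T" and z: "z \<in> D j" and KS: "K (t, wj_in x j z) \<in> S"
    for S t j z
  proof -
    let ?P = "{p \<in> topspace (prod_topology T (subtopology (X j) (D j))). k j p \<in> S}"
    have "openin (prod_topology T (subtopology (X j) (D j))) ?P"
      using k S by (rule openin_continuous_map_preimage)
    moreover have mem: "(t, z) \<in> ?P"
      using t z KS K topk by simp
    ultimately have "\<exists>A B. openin T A \<and> openin (subtopology (X j) (D j)) B \<and> t \<in> A \<and> z \<in> B \<and> A \<times> B \<subseteq> ?P"
      by (rule openin_prod_topology_alt[THEN iffD1, rule_format])
    then obtain A B where "openin T A" "openin (subtopology (X j) (D j)) B" "t \<in> A" "z \<in> B"
      and AB: "A \<times> B \<subseteq> ?P" by blast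
    moreover have "openin (X j) B \<and> B \<subseteq> D j"
      using \<open>openin (subtopology (X j) (D j)) B\<close> D(1) by (simp add: openin_open_subtopology)
    moreover have "K (u, wj_in x j w) \<in> S" if "u \<in> A" "w \<in> B" for u w
      using AB that K topk by fastforce
    ultimately show ?thesis by blast
  qed
  have "openin (prod_topology T (subtopology ?Y ?V)) {p \<in> topspace T \<times> ?V. K p \<in> S}"
    if S: "openin Z S" for S
    unfolding openin_prod_topology_alt
  proof (intro allI impI)
    fix t p assume tp: "(t, p) \<in> {p \<in> topspace T \<times> ?V. K p \<in> S}"
    then obtain i z where p: "p = wj_in x i z" "z \<in> D i" by blast
    from tp have t: "t \<in> topspace T" and KS: "K (t, p) \<in> S" by auto
    obtain A B where A: "openin T A" "t \<in> A" and B: "openin (X i) B" "z \<in> B" "B \<subseteq> D i"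
      and AB: "\<And>u w. u \<in> A \<Longrightarrow> w \<in> B \<Longrightarrow> K (u, wj_in x i w) \<in> S"
      using box[OF S t p(2)] KS p by metis
    \<comment> \<open>Any index serves here, because each \<open>x j\<close> represents the common
      point.\<close>
    have KN: "K (u, None) = c" if "u \<in> topspace T" for u
      using K[OF that D(2), of undefined] c[OF that] by simp
    have "\<exists>A N. openin T A \<and> openin ?Y N \<and> N \<subseteq> ?V \<and> t \<in> A \<and> p \<in> N \<and> (\<forall>u\<in>A. \<forall>q\<in>N. K (u, q) \<in> S)"
    proof (cases "c \<in> S")
      case False
      then have "x i \<notin> B"
        using AB[OF A(2), of "x i"] KN[OF t] by auto
      then show ?thesis
        using A B AB p
        by (intro exI[of _ A] exI[of _ "wj_in x i ` B"]) (auto intro: openin_weak_join_image)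
    next
      case True
      have "\<exists>A B. openin T A \<and> openin (X j) B \<and> t \<in> A \<and> x j \<in> B \<and> B \<subseteq> D j \<and>
               (\<forall>u\<in>A. \<forall>w\<in>B. K (u, wj_in x j w) \<in> S)" for j
        using box[OF S t D(2)] KN[OF t] True by simp
      then obtain A' B' where A': "\<And>j. openin T (A' j)" "\<And>j. t \<in> A' j"
        and B': "\<And>j. openin (X j) (B' j)" "\<And>j. x j \<in> B' j" "\<And>j. B' j \<subseteq> D j"
        and AB': "\<And>j u w. u \<in> A' j \<Longrightarrow> w \<in> B' j \<Longrightarrow> K (u, wj_in x j w) \<in> S"
        by metis
      \<comment> \<open>Outside the finite set \<open>F\<close> the whole of \<open>D j\<close> is
        mapped into \<open>S\<close>, whatever the parameter. Boxes matter only at indices in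
        \<open>F\<close>, so only finitely many parameter neighbourhoods are intersected.\<close>
      define F where "F = insert i {j. \<not> k j ` (topspace T \<times> D j) \<subseteq> S}"
      have F: "finite F" "i \<in> F" using fin[OF S True] by (auto simp: F_def)
      \<comment> \<open>At the index \<open>i\<close> of the point \<open>p\<close>, the box
        \<open>B\<close> around \<open>z\<close> is added to the one around \<open>x i\<close>, so
        that the set contains \<open>p\<close> as well as the common point.\<close>
      define E where "E j = (if j = i then B' j \<union> B else if j \<in> F then B' j else D j)" for j
      have E: "openin (X j) (E j)" "x j \<in> E j" "E j \<subseteq> D j" for j
        using B' B D by (auto simp: E_def)
      have "{j. E j \<noteq> topspace (X j)} \<subseteq> F \<union> {j. D j \<noteq> topspace (X j)}"
        using F by (auto simp: E_def)
      then have finE: "finite {j. E j \<noteq> topspace (X j)}"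
        using F(1) D(3) finite_subset by blast
      let ?A = "A \<inter> (\<Inter>j\<in>F. A' j)"
      have "openin T (\<Inter>j\<in>F. A' j)" using F A' by (intro openin_INT2) auto
      then have oA: "openin T ?A" using A by blast
      have KE: "K (u, wj_in x j w) \<in> S" if u: "u \<in> ?A" and w: "w \<in> E j" for u j w
      proof (cases "j \<in> F")
        case True
        then show ?thesis
          using u w AB AB' by (auto simp: E_def split: if_splits)
      next
        case False
        then have "u \<in> topspace T" "w \<in> D j" "k j ` (topspace T \<times> D j) \<subseteq> S"
          using u w E openin_subset[OF A(1)] by (auto simp: F_def)
        then show ?thesis using K[of u w j] by (auto simp: image_subset_iff)
      qed
      show ?thesis
      proof (intro exI[of _ ?A] exI[of _ "\<Union>j. wj_in x j ` E j"] conjI ballI)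
        show "openin ?Y (\<Union>j. wj_in x j ` E j)"
          using E finE by (intro openin_weak_join_Union) auto
        show "(\<Union>j. wj_in x j ` E j) \<subseteq> ?V" using E(3) by blast
        show "t \<in> ?A" using A A' by blast
        have "p \<in> wj_in x i ` E i" using p B by (auto simp: E_def)
        then show "p \<in> (\<Union>j. wj_in x j ` E j)" by blast
        show "K (u, q) \<in> S" if "u \<in> ?A" "q \<in> (\<Union>j. wj_in x j ` E j)" for u q
          using that KE by blast
      qed (rule oA)
    qed
    then obtain A N where "openin T A" "openin ?Y N" "N \<subseteq> ?V" "t \<in> A" "p \<in> N"
      "\<forall>u\<in>A. \<forall>q\<in>N. K (u, q) \<in> S" by blast
    then show "\<exists>U W. openin T U \<and> openin (subtopology ?Y ?V) W \<and> t \<in> U \<and> p \<in> W \<and>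
                 U \<times> W \<subseteq> {p \<in> topspace T \<times> ?V. K p \<in> S}"
      using V openin_subset[of T A]
      by (intro exI[of _ A] exI[of _ N]) (auto simp: openin_open_subtopology)
  qed
  moreover have "K (t, wj_in x i z) \<in> topspace Z" if "t \<in> topspace T" "z \<in> D i" for t i z
  proof -
    have "k i (t, z) \<in> topspace Z"
      using continuous_map_image_subset_topspace[OF k, of i] topk[of i] that by blast
    then show ?thesis using K that by simp
  qed
  ultimately show ?thesis
    unfolding continuous_map_def top by auto
qed

section \<open>Collapsing the first spaces of the join\<close>

definition wj_collapse :: "nat \<Rightarrow> (nat \<times> 'a) option \<Rightarrow> (nat \<times> 'a) option" where
  "wj_collapse m p = (case p of None \<Rightarrow> None | Some (i, z) \<Rightarrow> if i < m then None else p)"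

lemma wj_collapse_None [simp]: "wj_collapse m None = None"
  by (simp add: wj_collapse_def)

lemma wj_collapse_wj_in: "wj_collapse m (wj_in x i z) = (if i < m then None else wj_in x i z)"
  by (simp add: wj_collapse_def wj_in_def)

text \<open>\<open>wj_collapse m\<close> is the retraction \<open>r m\<close>: on each
  \<open>X i\<close> it is constant or the inclusion. The preimage of a set containing the common
  point contains each \<open>X i\<close> that the set contains, so the finiteness condition is
  inherited.\<close>

lemma continuous_map_wj_collapse:
  "continuous_map (weak_join X x) (weak_join X x) (wj_collapse m)"
proof -
  let ?Y = "weak_join X x"
  have car: "wj_collapse m p \<in> wj_carrier X x" if "p \<in> wj_carrier X x" for p
  proof -
    have "p = None \<or> (\<exists>i. \<exists>z\<in>topspace (X i). p = wj_in x i z)"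
      using that by (auto simp: wj_carrier_def)
    then show ?thesis
      by (elim disjE exE bexE) (simp_all add: wj_collapse_wj_in wj_in_carrier, simp_all add: wj_carrier_def)
  qed
  have "openin ?Y {p \<in> wj_carrier X x. wj_collapse m p \<in> S}" if S: "openin ?Y S" for S
    unfolding openin_weak_join
  proof (intro conjI allI impI)
    fix i
    let ?P = "{y \<in> topspace (X i). wj_in x i y \<in> {p \<in> wj_carrier X x. wj_collapse m p \<in> S}}"
    have "?P = (if i < m then if None \<in> S then topspace (X i) else {}
                else {y \<in> topspace (X i). wj_in x i y \<in> S})"
      by (auto simp: wj_in_carrier wj_collapse_wj_in)
    then show "openin (X i) ?P"
      using S by (simp add: openin_weak_join)
  next
    assume "None \<in> {p \<in> wj_carrier X x. wj_collapse m p \<in> S}"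
    then have "finite {i. \<not> wj_in x i ` topspace (X i) \<subseteq> S}" and "None \<in> S"
      using S by (auto simp: openin_weak_join)
    moreover from this(2) have "{i. \<not> wj_in x i ` topspace (X i) \<subseteq> {p \<in> wj_carrier X x. wj_collapse m p \<in> S}}
       \<subseteq> {i. \<not> wj_in x i ` topspace (X i) \<subseteq> S}"
      by (auto simp: wj_in_carrier wj_collapse_wj_in)
    ultimately show "finite {i. \<not> wj_in x i ` topspace (X i) \<subseteq> {p \<in> wj_carrier X x. wj_collapse m p \<in> S}}"
      using finite_subset by blast
  qed auto
  then show ?thesis using car by (simp add: continuous_map_def)
qed

section \<open>Neighbourhoods of the common point and their contraction\<close>

lemma shrinking_nbhd_sequence:
  assumes "first_countable_at Y y" "y \<in> topspace Y"
  obtains B :: "nat \<Rightarrow> 'b set" where "\<And>m. openin Y (B m)" "\<And>m. y \<in> B m"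
    "\<And>U. openin Y U \<Longrightarrow> y \<in> U \<Longrightarrow> \<exists>N. \<forall>m\<ge>N. B m \<subseteq> U"
proof -
  obtain \<B> where \<B>: "countable \<B>" "\<And>W. W \<in> \<B> \<Longrightarrow> openin Y W \<and> y \<in> W"
      "\<And>U. openin Y U \<Longrightarrow> y \<in> U \<Longrightarrow> \<exists>W\<in>\<B>. W \<subseteq> U"
    using assms(1) unfolding first_countable_at_def by auto
  have ne: "\<B> \<noteq> {}" using \<B>(3)[of "topspace Y"] assms(2) by auto
  \<comment> \<open>Intersecting initial segments of an enumeration of the base makes the sequence
    decreasing, so one member inside \<open>U\<close> settles all later ones.\<close>
  define B where "B m = (\<Inter>i\<le>m. from_nat_into \<B> i)" for m
  have mem: "from_nat_into \<B> i \<in> \<B>" for i using ne by (rule from_nat_into)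
  show ?thesis
  proof (rule that)
    show "openin Y (B m)" for m
      unfolding B_def using \<B>(2) mem by (intro openin_INT2) auto
    show "y \<in> B m" for m
      unfolding B_def using \<B>(2) mem by blast
    show "\<exists>N. \<forall>m\<ge>N. B m \<subseteq> U" if U: "openin Y U" "y \<in> U" for U
    proof -
      obtain W where W: "W \<in> \<B>" "W \<subseteq> U" using \<B>(3)[OF U] by blast
      obtain N where "from_nat_into \<B> N = W" using from_nat_into_surj[OF \<B>(1) W(1)] by blast
      then show ?thesis using W(2) unfolding B_def by blast
    qed
  qed
qed

text \<open>The contracting homotopy restricts to an open set inside the neighbourhood that the
  definition supplies. The end conditions hold for all \<open>z\<close> because
  \<open>homotopic_with\<close> prescribes the ends on the whole type.\<close>

lemma loc_strongly_contractible_openE: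
  assumes "loc_strongly_contractible Y y" "openin Y U" "y \<in> U"
  obtains V h where "openin Y V" "y \<in> V" "V \<subseteq> U"
    "continuous_map (prod_topology (top_of_set {0..1::real}) (subtopology Y V)) (subtopology Y U) h"
    "\<And>z. h (0, z) = z" "\<And>z. h (1, z) = y" "\<And>t. t \<in> {0..1} \<Longrightarrow> h (t, y) = y"
proof -
  have "nbhd Y y U"
    using assms openin_subset by (fastforce simp: nbhd_def)
  then obtain V' where V': "nbhd Y y V'" "V' \<subseteq> U"
    and hom: "homotopic_with (\<lambda>h. h y = y) (subtopology Y V') (subtopology Y U) id (\<lambda>_. y)"
    using assms(1) unfolding loc_strongly_contractible_def by blast
  from V'(1) obtain V where V: "openin Y V" "y \<in> V" "V \<subseteq> V'"
    unfolding nbhd_def by blast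
  have "homotopic_with (\<lambda>h. h y = y) (subtopology Y V) (subtopology Y U) id (\<lambda>_. y)"
    using homotopic_from_subtopology[OF hom, of V] V(3)
    by (simp add: subtopology_subtopology inf_absorb2)
  then show ?thesis
    unfolding homotopic_with_def using that V V'(2) by (metis id_apply subset_trans)
qed

text \<open>Collects what the later sections use about the join. For \<open>j < m\<close> the
  neighbourhood \<open>C j m\<close> is contracted inside \<open>B j m\<close>; for
  \<open>j >= m\<close> nothing moves. Only finitely many spaces are moved at each stage, so these
  homotopies fit together continuously.\<close>

lemma weak_join_local_retractions:
  fixes X :: "nat \<Rightarrow> 'a topology" and x :: "nat \<Rightarrow> 'a"
  assumes base: "\<And>i. x i \<in> topspace (X i)"
    and lsc: "\<And>i. loc_strongly_contractible (X i) (x i)"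
    and fc: "\<And>i. first_countable_at (X i) (x i)"
  obtains V W :: "nat \<Rightarrow> (nat \<times> 'a) option set" and r :: "nat \<Rightarrow> (nat \<times> 'a) option \<Rightarrow> (nat \<times> 'a) option"
  where "\<And>m. openin (weak_join X x) (V m)" "\<And>m. None \<in> V m"
    "\<And>U. openin (weak_join X x) U \<Longrightarrow> None \<in> U \<Longrightarrow> \<exists>N. \<forall>m\<ge>N. W m \<subseteq> U"
    "\<And>m. continuous_map (weak_join X x) (subtopology (weak_join X x) (W m)) (r m)"
    "\<And>m. homotopic_with (\<lambda>h. h None = None) (subtopology (weak_join X x) (V m))
        (subtopology (weak_join X x) (W m)) id (r m)"
proof -
  let ?Y = "weak_join X x"
  have "\<exists>B. (\<forall>m. openin (X i) (B m)) \<and> (\<forall>m. x i \<in> B m) \<and>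
            (\<forall>U. openin (X i) U \<longrightarrow> x i \<in> U \<longrightarrow> (\<exists>N::nat. \<forall>m\<ge>N. B m \<subseteq> U))" for i
    by (rule shrinking_nbhd_sequence[OF fc base, of i]) blast
  then obtain B where B: "\<And>i m. openin (X i) (B i m)" "\<And>i m. x i \<in> B i m"
    and Bb: "\<And>i U. openin (X i) U \<Longrightarrow> x i \<in> U \<Longrightarrow> \<exists>N::nat. \<forall>m\<ge>N. B i m \<subseteq> U"
    by metis
  have "\<exists>C h. openin (X i) C \<and> x i \<in> C \<and> C \<subseteq> B i m \<and>
      continuous_map (prod_topology (top_of_set {0..1::real}) (subtopology (X i) C)) (subtopology (X i) (B i m)) h \<and>
      (\<forall>z. h (0, z) = z) \<and> (\<forall>z. h (1, z) = x i) \<and> (\<forall>t\<in>{0..1}. h (t, x i) = x i)" for i m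
    by (rule loc_strongly_contractible_openE[OF lsc B, of i m]) blast
  then obtain C h where C: "\<And>i m. openin (X i) (C i m)" "\<And>i m. x i \<in> C i m" "\<And>i m. C i m \<subseteq> B i m"
    and h: "\<And>i m. continuous_map (prod_topology (top_of_set {0..1::real}) (subtopology (X i) (C i m)))
                 (subtopology (X i) (B i m)) (h i m)"
      "\<And>i m z. h i m (0, z) = z" "\<And>i m z. h i m (1, z) = x i"
      "\<And>i m t. t \<in> {0..1} \<Longrightarrow> h i m (t, x i) = x i"
    by metis
  \<comment> \<open>The index \<open>m\<close> plays two parts: it counts the spaces being collapsed
    and selects the stage of their neighbourhood bases, so that a single sequence shrinks in all
    spaces at once.\<close>
  define D where "D m j = (if j < m then C j m else topspace (X j))" for m j
  define W where "W m = (\<Union>j. wj_in x j ` (if j < m then B j m else topspace (X j)))" for m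
  define V where "V m = (\<Union>j. wj_in x j ` D m j)" for m
  have D: "openin (X j) (D m j)" "x j \<in> D m j" for m j
    using C base by (auto simp: D_def)
  have "{j. D m j \<noteq> topspace (X j)} \<subseteq> {..<m}" for m by (auto simp: D_def)
  then have finD: "finite {j. D m j \<noteq> topspace (X j)}" for m using finite_subset by blast
  show ?thesis
  proof (rule that[of V W wj_collapse])
    show "openin ?Y (V m)" for m
      unfolding V_def using D finD by (intro openin_weak_join_Union) auto
    show "None \<in> V m" for m
      unfolding V_def using D(2)[of m m] by (intro UN_I[of m] image_eqI[of _ _ "x m"]) auto
    show "\<exists>N. \<forall>m\<ge>N. W m \<subseteq> U" if U: "openin ?Y U" "None \<in> U" for U
    proof -
      have "finite {i. \<not> wj_in x i ` topspace (X i) \<subseteq> U}" using U by (simp add: openin_weak_join)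
      then obtain n where n: "\<And>i. \<not> wj_in x i ` topspace (X i) \<subseteq> U \<Longrightarrow> i < n"
        unfolding finite_nat_set_iff_bounded by blast
      have "\<exists>N. \<forall>m\<ge>N. B i m \<subseteq> {y \<in> topspace (X i). wj_in x i y \<in> U}" for i
        using U base by (intro Bb) (auto simp: openin_weak_join)
      then obtain N where N: "\<And>i m. m \<ge> N i \<Longrightarrow> B i m \<subseteq> {y \<in> topspace (X i). wj_in x i y \<in> U}"
        by metis
      \<comment> \<open>From \<open>n\<close> on the spaces lie in \<open>U\<close> entirely. The
        sum bounds all \<open>N i\<close> with \<open>i < n\<close>, and the summand
        \<open>n\<close> keeps these indices below \<open>m\<close>, where \<open>W m\<close> uses
        \<open>B i m\<close>.\<close>
      define M where "M = n + (\<Sum>i<n. N i)"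
      have M: "N i \<le> M" if "i < n" for i
        using member_le_sum[of i "{..<n}" N] that by (simp add: M_def)
      have "wj_in x j z \<in> U" if m: "m \<ge> M" and z: "z \<in> (if j < m then B j m else topspace (X j))" for m j z
      proof (cases "j < n")
        case True
        then have "j < m" "N j \<le> m" using M[OF True] m by (auto simp: M_def)
        then show ?thesis using z N[of j m] by auto
      next
        case False
        have "z \<in> topspace (X j)"
          using z openin_subset[OF B(1)] by (auto split: if_splits)
        then show ?thesis using n[of j] False by auto
      qed
      then have "\<forall>m\<ge>M. W m \<subseteq> U" unfolding W_def by blast
      then show ?thesis by blast
    qed
    have coll: "wj_collapse m p \<in> W m" if p: "p \<in> wj_carrier X x" for m p
    proof -
      have "None \<in> W m"
        unfolding W_def using base[of m] by (intro UN_I[of m] image_eqI[of _ _ "x m"]) auto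
      moreover have "wj_in x i z \<in> W m" if "\<not> i < m" "z \<in> topspace (X i)" for i z
        using that unfolding W_def by (intro UN_I[of i]) auto
      ultimately show ?thesis
        using p by (auto simp: wj_carrier_def wj_collapse_wj_in)
    qed
    show "continuous_map ?Y (subtopology ?Y (W m)) (wj_collapse m)" for m
      using coll by (simp add: continuous_map_in_subtopology continuous_map_wj_collapse image_subset_iff)
    show "homotopic_with (\<lambda>h. h None = None) (subtopology ?Y (V m)) (subtopology ?Y (W m)) id (wj_collapse m)" for m
    proof -
      \<comment> \<open>The contraction on the first \<open>m\<close> spaces, stationary on the
        others. The base points stay fixed throughout, so the pieces agree at the common
        point.\<close>
      define k where "k j = (\<lambda>(t, z). wj_in x j (if j < m then h j m (t, z) else z))" for j
      define K where "K = (\<lambda>(t, p). case p of None \<Rightarrow> None | Some (j, z) \<Rightarrow> k j (t, z))"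
      have kx: "k j (t, x j) = None" if "t \<in> {0..1}" for j t
        using h(4)[OF that] by (simp add: k_def)
      have K: "K (t, wj_in x j z) = k j (t, z)" if "t \<in> {0..1}" for t j z
        using kx[OF that] by (auto simp: K_def wj_in_def)
      have hB: "h j m (t, z) \<in> B j m" if "t \<in> {0..1}" "z \<in> C j m" for j t z
        using continuous_map_image_subset_topspace[OF h(1)[of j m]] that openin_subset[OF C(1)[of j m]]
        by (auto simp: topspace_prod_topology image_subset_iff)
      have KW: "K (t, p) \<in> W m" if t: "t \<in> {0..1}" and p: "p \<in> V m" for t p
      proof -
        obtain j z where pz: "p = wj_in x j z" "z \<in> D m j" using p by (auto simp: V_def)
        have "(if j < m then h j m (t, z) else z) \<in> (if j < m then B j m else topspace (X j))"
          using pz(2) hB[OF t, of z j] by (auto simp: D_def)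
        then show ?thesis
          unfolding pz(1) K[OF t] k_def W_def by (intro UN_I[of j]) simp_all
      qed
      have "continuous_map (prod_topology (top_of_set {0..1::real}) (subtopology ?Y (V m))) ?Y K"
        unfolding V_def
      proof (rule continuous_map_weak_join_parametric[where k = k and c = None])
        show "continuous_map (prod_topology (top_of_set {0..1}) (subtopology (X j) (D m j))) ?Y (k j)" for j
        proof (cases "j < m")
          case True
          have "continuous_map (prod_topology (top_of_set {0..1}) (subtopology (X j) (D m j))) (X j) (h j m)"
            using h(1)[of j m] True by (simp add: D_def continuous_map_in_subtopology)
          from continuous_map_compose[OF this continuous_map_wj_in[where X = X and x = x and i = j]] True show ?thesis
            by (simp add: k_def o_def case_prod_unfold)
        next
          case False
          have "continuous_map (prod_topology (top_of_set {0..1::real}) (subtopology (X j) (D m j))) (X j) snd"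
            using continuous_map_snd continuous_map_in_subtopology by metis
          from continuous_map_compose[OF this continuous_map_wj_in[where X = X and x = x and i = j]] False show ?thesis
            by (simp add: k_def o_def case_prod_unfold)
        qed
        \<comment> \<open>For \<open>j >= m\<close> the image of \<open>k j\<close> is that of
          \<open>X j\<close>, so finiteness comes from the openness of \<open>S\<close>.\<close>
        show "finite {j. \<not> k j ` (topspace (top_of_set {0..1}) \<times> D m j) \<subseteq> S}"
          if S: "openin ?Y S" "None \<in> S" for S
        proof -
          have "{j. \<not> k j ` (topspace (top_of_set {0..1}) \<times> D m j) \<subseteq> S}
                \<subseteq> {..<m} \<union> {j. \<not> wj_in x j ` topspace (X j) \<subseteq> S}"
            by (auto simp: k_def D_def)
          moreover have "finite {j. \<not> wj_in x j ` topspace (X j) \<subseteq> S}"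
            using S by (simp add: openin_weak_join)
          ultimately show ?thesis using finite_subset by blast
        qed
      qed (use D finD kx K in auto)
      then have cK: "continuous_map (prod_topology (top_of_set {0..1::real}) (subtopology ?Y (V m)))
                       (subtopology ?Y (W m)) K"
        using KW by (auto simp: continuous_map_in_subtopology topspace_prod_topology)
      \<comment> \<open>The ends may be compared on the domain alone once the base point condition
        depends only on values there; for this the common point must belong to
        \<open>V m\<close>.\<close>
      have V0: "None \<in> topspace (subtopology ?Y (V m))"
        using \<open>None \<in> V m\<close> by (auto simp: wj_carrier_def)
      have "K (0, p) = p \<and> K (1, p) = wj_collapse m p" if "p \<in> topspace (subtopology ?Y (V m))" for p
      proof -
        have "p \<in> V m" using that by simp
        then obtain j z where pz: "p = wj_in x j z" "z \<in> D m j" unfolding V_def by blast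
        show ?thesis
          unfolding pz(1) using K[of 0 j z] K[of 1 j z] h(2,3)
          by (simp add: k_def wj_collapse_wj_in)
      qed
      moreover have "K (t, None) = None" if "t \<in> {0..1}" for t
        by (simp add: K_def)
      ultimately show ?thesis
        using cK by (intro homotopic_with[THEN iffD2] exI[of _ K] conjI ballI) (simp_all add: V0 del: topspace_subtopology)
    qed
  qed
qed

section \<open>Spheres of the Hawaiian earring as quotients of the cube\<close>

lemma infnorm_le_iff_cart: "infnorm (u::real^'n) \<le> c \<longleftrightarrow> (\<forall>i. \<bar>u$i\<bar> \<le> c)"
  unfolding infnorm_cart by (subst cSup_eq_Max) (auto simp: full_SetCompr_eq)

lemma infnorm_less_iff_cart: "infnorm (u::real^'n) < c \<longleftrightarrow> (\<forall>i. \<bar>u$i\<bar> < c)"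
  unfolding infnorm_cart by (subst cSup_eq_Max) (auto simp: full_SetCompr_eq)

text \<open>In the coordinate \<open>2 t - 1\<close> the cube is the unit ball of the maximum norm.
  \<open>cube_to_sphere\<close> turns this norm, times \<open>pi\<close>, into the polar angle, so
  the boundary goes to the pole opposite the image of the centre.\<close>

lemma mem_cbox_01_iff_infnorm: "t \<in> cbox 0 1 \<longleftrightarrow> infnorm (2 *\<^sub>R (t::real^'n) - 1) \<le> 1"
proof -
  have "0 \<le> t$i \<and> t$i \<le> 1 \<longleftrightarrow> \<bar>2 * t$i - 1\<bar> \<le> 1" for i by (auto simp: abs_if)
  then show ?thesis by (simp add: infnorm_le_iff_cart mem_box_cart)
qed

lemma mem_box_01_iff_infnorm: "t \<in> box 0 1 \<longleftrightarrow> infnorm (2 *\<^sub>R (t::real^'n) - 1) < 1"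
proof -
  have "0 < t$i \<and> t$i < 1 \<longleftrightarrow> \<bar>2 * t$i - 1\<bar> < 1" for i by (auto simp: abs_if)
  then show ?thesis by (simp add: infnorm_less_iff_cart mem_box_cart)
qed

lemma mem_cube_bd_iff_infnorm: "t \<in> cube_bd \<longleftrightarrow> infnorm (2 *\<^sub>R (t::real^'n) - 1) = 1"
  by (auto simp: cube_bd_def mem_cbox_01_iff_infnorm mem_box_01_iff_infnorm)

lemma mem_cube_bd_iff: "t \<in> cube_bd \<longleftrightarrow> (t::real^'n) \<in> cbox 0 1 \<and> (\<exists>i. t$i = 0 \<or> t$i = 1)"
  unfolding cube_bd_def Diff_iff mem_box_cart
  by (metis less_irrefl order.order_iff_strict zero_index one_index)

lemma cube_bd_subset: "cube_bd \<subseteq> cbox 0 (1::real^'n)"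
  by (auto simp: cube_bd_def)

lemma zero_in_cube_bd: "(0::real^'n) \<in> cube_bd"
  by (simp add: mem_cube_bd_iff mem_box_cart)

lemma sum_UNIV_option: "(\<Sum>j\<in>UNIV. f j) = f None + (\<Sum>i\<in>UNIV. f (Some (i::'n::finite)))"
  by (simp add: UNIV_option_conv sum.reindex)

lemma norm_square_option:
  "(norm (p::real^('n::finite option)))\<^sup>2 = (p$None)\<^sup>2 + (\<Sum>i\<in>UNIV. (p$(Some i))\<^sup>2)"
  by (simp add: norm_vec_def L2_set_def sum_nonneg sum_UNIV_option)

lemma norm_square_cart: "(norm (u::real^'n))\<^sup>2 = (\<Sum>i\<in>UNIV. (u$i)\<^sup>2)"
  by (simp add: norm_vec_def L2_set_def sum_nonneg)

text \<open>Cancelling the constant terms leaves \<open>k\<close> in one place only, from which both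
  the bound on the norm and the uniqueness of \<open>k\<close> are read off.\<close>

lemma mem_hsphere_iff: "p \<in> hsphere k \<longleftrightarrow> (norm p)\<^sup>2 = 2 * p$None / real k"
proof -
  have "(p$None - 1 / real k)\<^sup>2 = (p$None)\<^sup>2 - 2 * p$None / real k + (1 / real k)\<^sup>2"
    by (simp add: power2_diff)
  then show ?thesis by (auto simp: hsphere_def norm_square_option)
qed

lemma norm_le_hsphere:
  assumes "p \<in> hsphere k"
  shows "norm p \<le> 2 / real k"
proof (cases "p = 0")
  case False
  have "(norm p)\<^sup>2 \<le> 2 * norm p / real k"
    using assms component_le_norm_cart[of p None]
    by (simp add: mem_hsphere_iff divide_right_mono)
  then have "norm p * norm p \<le> 2 / real k * norm p" by (simp add: power2_eq_square)
  then show ?thesis using False by (simp only: mult_le_cancel_right) simp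
qed simp

text \<open>Makes the choice of \<open>k\<close> in \<open>hw_concat\<close> unambiguous away from
  the base point.\<close>

lemma hsphere_unique:
  assumes "k \<ge> 1" "l \<ge> 1" "p \<in> hsphere k" "p \<in> hsphere l" "p \<noteq> 0"
  shows "k = l"
proof -
  have "2 * p$None / real k = 2 * p$None / real l" "2 * p$None / real k \<noteq> 0"
    using assms mem_hsphere_iff[of p k] mem_hsphere_iff[of p l] by auto
  then show ?thesis using assms by (auto simp: field_simps)
qed

section \<open>Parametrising the spheres by the cube\<close>

lemma sk_param_None:
  "sk_param k (t::real^'n::finite) $ None = (1 + cos (pi * infnorm (2 *\<^sub>R t - 1))) / real k"
  by (simp add: sk_param_def cube_to_sphere_def Let_def axis_def)

lemma sk_param_Some:
  "sk_param k (t::real^'n::finite) $ Some i =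
     sin (pi * infnorm (2 *\<^sub>R t - 1)) * ((2 *\<^sub>R t - 1)$i / norm (2 *\<^sub>R t - 1)) / real k"
  by (simp add: sk_param_def cube_to_sphere_def Let_def axis_def)

lemma sk_param_cube_bd: "t \<in> cube_bd \<Longrightarrow> sk_param k (t::real^'n::finite) = 0"
  unfolding vec_eq_iff
proof
  show "sk_param k t $ j = 0 $ j" if "t \<in> cube_bd" for j
    using that by (cases j) (simp_all only: sk_param_None sk_param_Some mem_cube_bd_iff_infnorm, simp_all)
qed

lemma sk_param_in_hsphere:
  assumes "k \<ge> 1"
  shows "sk_param k (t::real^'n::finite) \<in> hsphere k"
proof -
  define u where "u = 2 *\<^sub>R t - 1"
  define a where "a = pi * infnorm u"
  \<comment> \<open>At the centre of the cube the direction \<open>u / norm u\<close> is zero by the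
    convention for division; the sine vanishes there too.\<close>
  have n: "(\<Sum>i\<in>UNIV. (sin a * (u$i / norm u))\<^sup>2) = (sin a)\<^sup>2"
  proof (cases "u = 0")
    case True
    then show ?thesis by (simp add: a_def infnorm_0)
  next
    case False
    have "(\<Sum>i\<in>UNIV. (sin a * (u$i / norm u))\<^sup>2) = (sin a)\<^sup>2 * ((\<Sum>i\<in>UNIV. (u$i)\<^sup>2) / (norm u)\<^sup>2)"
      by (simp add: power_mult_distrib power_divide sum_distrib_left sum_divide_distrib)
    then show ?thesis using False by (simp flip: norm_square_cart)
  qed
  have "(sk_param k t $ None - 1 / real k)\<^sup>2 = (cos a)\<^sup>2 / (real k)\<^sup>2"
    unfolding sk_param_None a_def u_def by (simp add: add_divide_distrib power_divide)
  moreover have "(\<Sum>i\<in>UNIV. (sk_param k t $ Some i)\<^sup>2) = (sin a)\<^sup>2 / (real k)\<^sup>2"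
  proof -
    have "(sk_param k t $ Some i)\<^sup>2 = (sin a * (u$i / norm u))\<^sup>2 / (real k)\<^sup>2" for i
      unfolding sk_param_Some a_def u_def by (rule power_divide)
    then show ?thesis by (simp only: n sum_divide_distrib[symmetric])
  qed
  moreover have "(cos a)\<^sup>2 / (real k)\<^sup>2 + (sin a)\<^sup>2 / (real k)\<^sup>2 = (1 / real k)\<^sup>2"
    by (simp only: add_divide_distrib[symmetric] sin_cos_squared_add2 power_divide power_one)
  ultimately show ?thesis
    unfolding hsphere_def mem_Collect_eq by simp
qed

lemma sk_param_in_hawaiian: "k \<ge> 1 \<Longrightarrow> sk_param k (t::real^'n::finite) \<in> hawaiian"
  using sk_param_in_hsphere by (auto simp: hawaiian_def)

lemma cos_pi_mult_inj:
  fixes a b :: real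
  assumes "0 \<le> a" "a \<le> 1" "0 \<le> b" "b \<le> 1" "cos (pi * a) = cos (pi * b)"
  shows "a = b"
proof -
  have "pi * a = pi * b"
    using assms(1-4) by (intro cos_inj_pi[OF _ _ _ _ assms(5)]) (simp_all add: mult_left_le)
  then show ?thesis by simp
qed

lemma sk_param_eq_0_iff:
  assumes "k \<ge> 1" "t \<in> cbox 0 1"
  shows "sk_param k (t::real^'n::finite) = 0 \<longleftrightarrow> t \<in> cube_bd"
proof
  assume "sk_param k t = 0"
  then have "sk_param k t $ None = 0" by simp
  then have eq: "cos (pi * infnorm (2 *\<^sub>R t - 1)) = cos (pi * 1)"
    unfolding sk_param_None using assms(1) by (simp add: add_eq_0_iff)
  have "infnorm (2 *\<^sub>R t - 1) = 1"
    by (rule cos_pi_mult_inj[OF _ _ _ _ eq])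
      (use assms(2) in \<open>simp_all add: mem_cbox_01_iff_infnorm infnorm_pos_le\<close>)
  then show "t \<in> cube_bd" by (simp add: mem_cube_bd_iff_infnorm)
qed (rule sk_param_cube_bd)

text \<open>The coordinate \<open>None\<close> determines the angle, hence the maximum norm of
  \<open>u\<close>. Dividing the other coordinates by the sine, which is positive inside the cube
  and off its centre, yields the direction. Both together determine \<open>u\<close>.\<close>

lemma sk_param_inj_on_box:
  assumes "k \<ge> 1" and s: "s \<in> box 0 1" and t: "t \<in> box 0 1"
    and eq: "sk_param k s = sk_param k (t::real^'n::finite)"
  shows "s = t"
proof -
  define u v where "u = 2 *\<^sub>R s - 1" and "v = 2 *\<^sub>R t - 1"
  have inf: "infnorm u < 1" "infnorm v < 1"
    using s t by (simp_all add: mem_box_01_iff_infnorm u_def v_def)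
  have "sk_param k s $ None = sk_param k t $ None" using eq by simp
  then have eqc: "cos (pi * infnorm u) = cos (pi * infnorm v)"
    unfolding sk_param_None u_def v_def using assms(1) by simp
  have iuv: "infnorm u = infnorm v"
    by (rule cos_pi_mult_inj[OF _ _ _ _ eqc]) (use inf in \<open>simp_all add: infnorm_pos_le\<close>)
  have "u = v"
  proof (cases "u = 0")
    case True
    then show ?thesis using iuv by (metis infnorm_0 infnorm_eq_0)
  next
    case False
    then have v0: "v \<noteq> 0" and pos: "infnorm u > 0"
      using iuv by (auto simp: infnorm_pos_lt infnorm_0 infnorm_eq_0)
    have sinpos: "sin (pi * infnorm u) > 0"
      using pos inf by (intro sin_gt_zero) auto
    have comp: "u$i / norm u = v$i / norm v" for i
    proof -
      have "sin (pi * infnorm u) * (u$i / norm u) / real k = sin (pi * infnorm u) * (v$i / norm v) / real k"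
        using eq sk_param_Some[of k s i] sk_param_Some[of k t i] iuv by (simp only: u_def v_def)
      moreover have "a = b" if "c * a / d = c * b / d" "c > 0" "d > 0" for a b c d :: real
        using that by simp
      ultimately show ?thesis using sinpos assms(1) by (metis of_nat_0_less_iff less_le_trans zero_less_one)
    qed
    define c where "c = norm u / norm v"
    have "c \<ge> 0" by (simp add: c_def)
    have uv: "u = c *\<^sub>R v"
      using comp False v0 by (simp add: c_def vec_eq_iff field_simps)
    then have "infnorm v = c * infnorm v"
      using iuv \<open>c \<ge> 0\<close> by (simp add: infnorm_mul)
    then have "c = 1" using iuv pos by simp
    then show ?thesis using uv by simp
  qed
  then show ?thesis by (simp add: u_def v_def)
qed

text \<open>The point is moved to the unit sphere, with coordinates \<open>c\<close> and
  \<open>v\<close>. The angle is \<open>arccos c\<close>, and the multiple of \<open>v\<close> with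
  the right maximum norm is the centred cube coordinate \<open>u\<close>.\<close>

lemma sk_param_surj:
  assumes k: "k \<ge> 1" and p: "p \<in> hsphere k"
  obtains t :: "real^'n::finite" where "t \<in> cbox 0 1" "sk_param k t = p"
proof (cases "p = 0")
  case True
  then show ?thesis
    using that[of 0] zero_in_cube_bd cube_bd_subset sk_param_cube_bd by blast
next
  case False
  define c where "c = real k * p$None - 1"
  define v :: "real^'n" where "v = (\<chi> i. real k * p$(Some i))"
  have "(real k)\<^sup>2 * ((p$None - 1 / real k)\<^sup>2 + (\<Sum>i\<in>UNIV. (p$(Some i))\<^sup>2)) = 1"
    using p k by (simp add: hsphere_def power_divide)
  moreover have "(real k)\<^sup>2 * (p$None - 1 / real k)\<^sup>2 = c\<^sup>2"
    using k by (simp add: c_def field_simps flip: power_mult_distrib)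
  moreover have "(real k)\<^sup>2 * (\<Sum>i\<in>UNIV. (p$(Some i))\<^sup>2) = (norm v)\<^sup>2"
    by (simp add: norm_square_cart v_def sum_distrib_left power_mult_distrib)
  ultimately have cv: "c\<^sup>2 + (norm v)\<^sup>2 = 1" by (simp add: distrib_left)
  have "c\<^sup>2 \<le> 1" using cv zero_le_power2[of "norm v"] by linarith
  then have "\<bar>c\<bar> \<le> 1" by (simp add: abs_square_le_1)
  then have c1: "-1 \<le> c" "c \<le> 1" by auto
  define a where "a = arccos c"
  have a: "0 \<le> a" "a \<le> pi" "cos a = c" using c1 by (auto simp: a_def arccos_lbound arccos_ubound)
  have sina: "sin a = norm v"
  proof -
    have "(sin a)\<^sup>2 = (norm v)\<^sup>2" using cv a by (simp add: sin_squared_eq)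
    then show ?thesis using a by (simp add: sin_ge_zero)
  qed
  \<comment> \<open>For \<open>v = 0\<close> there is no direction to use. As \<open>p\<close> is
    not the base point, \<open>c\<close> is 1 and the centre of the cube is taken.\<close>
  obtain u :: "real^'n" where u: "infnorm u = a / pi" "\<And>i. sin a * (u$i / norm u) = v$i"
  proof (cases "v = 0")
    case True
    have "c \<noteq> -1"
    proof
      assume "c = -1"
      then have "p $ j = 0" for j
        using True k by (cases j) (auto simp: c_def v_def vec_eq_iff)
      then show False using False by (simp add: vec_eq_iff)
    qed
    then have "c = 1" using True cv by (auto simp: power2_eq_1_iff)
    then have "a = 0" by (simp add: a_def)
    then show ?thesis using that[of 0] True by (simp add: infnorm_0)
  next
    case False
    have ip: "infnorm v > 0" using False by (simp add: infnorm_pos_lt)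
    have "a \<noteq> 0" using sina False by auto
    then have ap: "a > 0" using a by simp
    define b where "b = a / pi / infnorm v"
    have b: "b > 0" using ap ip by (simp add: b_def)
    show ?thesis
    proof (rule that[of "b *\<^sub>R v"])
      show "infnorm (b *\<^sub>R v) = a / pi"
        using b ip by (simp add: infnorm_mul) (simp add: b_def)
      show "sin a * ((b *\<^sub>R v)$i / norm (b *\<^sub>R v)) = v$i" for i
        using b False by (simp add: sina)
    qed
  qed
  define t where "t = (1/2) *\<^sub>R (u + 1)"
  have ut: "2 *\<^sub>R t - 1 = u" by (simp add: t_def)
  show ?thesis
  proof (rule that[of t])
    show "t \<in> cbox 0 1"
      using a by (simp add: mem_cbox_01_iff_infnorm ut u(1))
    show "sk_param k t = p"
      unfolding vec_eq_iff
    proof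
      show "sk_param k t $ j = p $ j" for j
      proof (cases j)
        case None
        show ?thesis unfolding None sk_param_None ut u(1) using a k by (simp add: c_def)
      next
        case (Some i)
        have "pi * (a / pi) = a" by simp
        then show ?thesis unfolding Some sk_param_Some ut u(1) using u(2)[of i] k by (simp add: v_def)
      qed
    qed
  qed
qed

lemma hawaiian_cases:
  assumes "p \<in> hawaiian"
  obtains k and t :: "real^'n::finite" where "k \<ge> 1" "t \<in> cbox 0 1" "p = sk_param k t"
proof -
  obtain k where "k \<ge> 1" "p \<in> hsphere k" using assms by (auto simp: hawaiian_def)
  then show ?thesis using that sk_param_surj by metis
qed

text \<open>Only the centre needs care: there the direction is discontinuous, but it is bounded by 1
  in each coordinate and multiplied by a sine tending to 0.\<close>

lemma continuous_on_sk_param: "continuous_on S (sk_param k :: real^'n::finite \<Rightarrow> _)"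
proof -
  define g where "g i u = sin (pi * infnorm u) * (u$i / norm u)" for i and u :: "real^'n"
  have "isCont (g i) u" for i u
  proof (cases "u = 0")
    case True
    have "((\<lambda>v::real^'n. sin (pi * infnorm v)) \<longlongrightarrow> sin (pi * infnorm (0::real^'n))) (at 0)"
      by (intro tendsto_intros)
    then have lim: "((\<lambda>v::real^'n. sin (pi * infnorm v)) \<longlongrightarrow> 0) (at 0)" by (simp add: infnorm_0)
    have "\<bar>v$i / norm v\<bar> \<le> 1" for v :: "real^'n"
      using component_le_norm_cart[of v i] by (cases "v = 0") (auto simp: divide_simps)
    then have "norm (g i v) \<le> norm (sin (pi * infnorm v))" for v
      unfolding g_def by (simp only: real_norm_def abs_mult mult_left_le abs_ge_zero)
    then have "(g i \<longlongrightarrow> 0) (at 0)"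
      using lim by (intro Lim_null_comparison[OF _ tendsto_norm_zero[OF lim]]) auto
    then show ?thesis using True by (simp add: isCont_def g_def)
  next
    case False
    then show ?thesis unfolding g_def by (intro continuous_intros) auto
  qed
  then have g: "continuous_on UNIV (g i)" for i by (simp add: continuous_on_eq_continuous_at)
  have "continuous_on S (\<lambda>t. \<chi> j. case j of None \<Rightarrow> (1 + cos (pi * infnorm (2 *\<^sub>R t - 1))) / real k
               | Some i \<Rightarrow> g i (2 *\<^sub>R (t::real^'n) - 1) / real k)"
  proof (rule continuous_on_vec_lambda)
    fix j :: "'n option"
    show "continuous_on S (\<lambda>t. case j of None \<Rightarrow> (1 + cos (pi * infnorm (2 *\<^sub>R t - 1))) / real k
               | Some i \<Rightarrow> g i (2 *\<^sub>R (t::real^'n) - 1) / real k)"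
    proof (cases j)
      case None
      then show ?thesis by (auto intro!: continuous_intros simp: divide_inverse)
    next
      case (Some i)
      have "continuous_on S (\<lambda>t. g i (2 *\<^sub>R t - 1))"
        by (rule continuous_on_compose2[OF g]) (auto intro!: continuous_intros)
      then show ?thesis using Some by (simp add: divide_inverse continuous_on_mult_right)
    qed
  qed
  moreover have "sk_param k = (\<lambda>t. \<chi> j. case j of None \<Rightarrow> (1 + cos (pi * infnorm (2 *\<^sub>R t - 1))) / real k
               | Some i \<Rightarrow> g i (2 *\<^sub>R (t::real^'n) - 1) / real k)"
    by (intro ext, simp only: vec_eq_iff)
      (auto simp only: sk_param_None sk_param_Some g_def vec_lambda_beta split: option.split)
  ultimately show ?thesis by simp
qed

section \<open>Gluing null-convergent families\<close>

text \<open>\<open>hw_concat\<close> with an arbitrary family of cube maps in place of the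
  concatenations, so that one continuity proof covers concatenations, families and
  homotopies.\<close>

definition hw_glue :: "'b \<Rightarrow> (nat \<Rightarrow> real^'n::finite \<Rightarrow> 'b) \<Rightarrow> real^('n option) \<Rightarrow> 'b" where
  "hw_glue y F = (\<lambda>p. if p \<in> hawaiian - {0} then
       (let k = (SOME k. 1 \<le> k \<and> p \<in> hsphere k);
            t = (SOME t::real^'n. t \<in> box 0 1 \<and> sk_param k t = p)
        in F k t)
     else y)"

lemma hw_concat_eq_glue:
  "hw_concat y f g = hw_glue y (\<lambda>k. cube_concat (f \<circ> sk_param k) (g \<circ> sk_param k))"
  by (simp add: hw_concat_def hw_glue_def)

lemma hw_glue_0 [simp]: "hw_glue y F 0 = y"
  by (simp add: hw_glue_def)

text \<open>For interior points both choices are forced, by \<open>hsphere_unique\<close> and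
  \<open>sk_param_inj_on_box\<close>; boundary points are sent to \<open>0\<close>, where both sides
  are \<open>y\<close>.\<close>

lemma hw_glue_sk_param:
  fixes F :: "nat \<Rightarrow> real^'n::finite \<Rightarrow> 'b"
  assumes k: "k \<ge> 1" and t: "t \<in> cbox 0 1" and bd: "\<And>t. t \<in> cube_bd \<Longrightarrow> F k t = y"
  shows "hw_glue y F (sk_param k t) = F k t"
proof (cases "t \<in> cube_bd")
  case True
  then show ?thesis using bd by (simp add: sk_param_cube_bd)
next
  case False
  then have tb: "t \<in> box 0 1" using t by (simp add: cube_bd_def)
  let ?p = "sk_param k t"
  have p: "?p \<in> hawaiian - {0}" using False k t by (simp add: sk_param_in_hawaiian sk_param_eq_0_iff)
  have K: "(SOME k. 1 \<le> k \<and> ?p \<in> hsphere k) = k"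
    using k p sk_param_in_hsphere hsphere_unique by (intro some_equality) blast+
  have T: "(SOME s::real^'n. s \<in> box 0 1 \<and> sk_param k s = ?p) = t"
    using k tb sk_param_inj_on_box by (intro some_equality) blast+
  show ?thesis
    unfolding hw_glue_def Let_def K T using p by (rule if_P)
qed

text \<open>Compactness of \<open>S\<close> and of the cube makes each sphere's share of the
  preimage of a closed set compact. Null-convergence controls how these infinitely many pieces
  accumulate at \<open>0\<close>. With \<open>S\<close> a point this gives maps, with
  \<open>S\<close> an interval homotopies.\<close>

lemma continuous_map_hw_glue:
  fixes F :: "nat \<Rightarrow> 'c::metric_space \<times> (real^'n::finite) \<Rightarrow> 'b"
  assumes S: "compact S"
    and F: "\<And>k. k \<ge> 1 \<Longrightarrow> continuous_map (top_of_set (S \<times> cbox 0 1)) Y (F k)"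
    and bd: "\<And>k s t. k \<ge> 1 \<Longrightarrow> s \<in> S \<Longrightarrow> t \<in> cube_bd \<Longrightarrow> F k (s, t) = y"
    and null: "\<And>U. openin Y U \<Longrightarrow> y \<in> U \<Longrightarrow> \<exists>N. \<forall>k\<ge>N. F k ` (S \<times> cbox 0 1) \<subseteq> U"
  shows "continuous_map (top_of_set (S \<times> hawaiian)) Y (\<lambda>(s, p). hw_glue y (\<lambda>k t. F k (s, t)) p)"
    (is "continuous_map _ _ ?G")
proof -
  have G: "?G (s, sk_param k t) = F k (s, t)" if "s \<in> S" "k \<ge> 1" "t \<in> cbox 0 1" for s k t
    using that bd by (simp add: hw_glue_sk_param)
  have "closedin (top_of_set (S \<times> hawaiian)) {z \<in> S \<times> hawaiian. ?G z \<in> C}"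
    if C: "closedin Y C" for C
  proof -
    define A where "A = {z \<in> S \<times> hawaiian. ?G z \<in> C}"
    define K where "K k = (\<lambda>(s, t). (s, sk_param k t)) ` {z \<in> S \<times> cbox 0 1. F k z \<in> C}" for k
    have cK: "compact (K k)" if k: "k \<ge> 1" for k
      unfolding K_def
    proof (rule compact_continuous_image)
      have "closedin (top_of_set (S \<times> cbox 0 1)) {z \<in> S \<times> cbox 0 1. F k z \<in> C}"
        using closedin_continuous_map_preimage[OF F[OF k] C] by simp
      then show "compact {z \<in> S \<times> cbox 0 1. F k z \<in> C}"
        using S by (intro closedin_compact[OF compact_Times[OF S compact_cbox]])
      show "continuous_on {z \<in> S \<times> cbox 0 1. F k z \<in> C} (\<lambda>(s, t). (s, sk_param k t))"
        unfolding case_prod_unfold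
        by (intro continuous_intros continuous_on_compose2[OF continuous_on_sk_param]) auto
    qed
    have KA: "K k \<subseteq> A" if "k \<ge> 1" for k
      using that G by (auto simp: K_def A_def sk_param_in_hawaiian simp del: case_prod_conv)
    have AK: "\<exists>k\<ge>1. z \<in> K k" if "z \<in> A" for z
    proof -
      obtain s p where sp: "z = (s, p)" by (cases z)
      then have z: "z = (s, p)" "s \<in> S" "p \<in> hawaiian" "?G (s, p) \<in> C"
        using that by (auto simp: A_def)
      obtain k and t :: "real^'n" where "k \<ge> 1" "t \<in> cbox 0 1" "p = sk_param k t"
        using z(3) by (rule hawaiian_cases)
      then show ?thesis using z G by (auto simp: K_def intro!: exI[of _ k] image_eqI[of _ _ "(s, t)"])
    qed
    have cKN: "closed (\<Union>k\<in>{1..N}. K k)" for N :: nat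
      using cK by (intro closed_UN) (auto intro: compact_imp_closed)
    have "closed A"
    proof (cases "y \<in> C")
      case False
      \<comment> \<open>This makes the complement of \<open>C\<close> a neighbourhood of
        \<open>y\<close>; null-convergence then leaves only finitely many nonempty
        \<open>K k\<close>. For empty \<open>S\<close> all images are empty anyway.\<close>
      have "y \<in> topspace Y" if "s \<in> S" for s
        using continuous_map_image_subset_topspace[OF F[of 1]] bd[OF _ that zero_in_cube_bd, of 1]
          that zero_in_cube_bd cube_bd_subset by fastforce
      then have "\<exists>N. \<forall>k\<ge>N. F k ` (S \<times> cbox 0 1) \<subseteq> topspace Y - C"
        using False C null[of "topspace Y - C"] by (cases "S = {}") (auto simp: closedin_def)
      then obtain N where N: "\<And>k. k \<ge> N \<Longrightarrow> K k = {}"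
        unfolding K_def by blast
      have "A = (\<Union>k\<in>{1..N}. K k)"
      proof (intro equalityI subsetI)
        fix z assume "z \<in> A"
        then obtain k where k: "k \<ge> 1" "z \<in> K k" using AK by blast
        then have "k \<le> N" using N[of k] by (cases "k \<le> N") auto
        then show "z \<in> (\<Union>k\<in>{1..N}. K k)" using k by auto
      next
        fix z assume "z \<in> (\<Union>k\<in>{1..N}. K k)"
        then obtain k where "k \<ge> 1" "z \<in> K k" by auto
        then show "z \<in> A" using KA by blast
      qed
      then show ?thesis using cKN by simp
    next
      case True
      \<comment> \<open>The ball of radius \<open>2 / Suc N\<close> contains every sphere beyond the
        \<open>N\<close>-th. So each set on the right is closed and contains \<open>A\<close>, and
        their intersection adds only points over \<open>0\<close>, which belong to \<open>A\<close>
        because \<open>y\<close> lies in \<open>C\<close>.\<close>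
      have "A = (\<Inter>N. S \<times> cball 0 (2 / real (Suc N)) \<union> (\<Union>k\<in>{1..N}. K k))" (is "_ = ?B")
      proof (intro equalityI subsetI)
        fix z assume z: "z \<in> A"
        obtain k where k: "k \<ge> 1" "z \<in> K k" using AK[OF z] by blast
        have "z \<in> S \<times> cball 0 (2 / real (Suc N))" if "k > N" for N
        proof -
          have "norm (snd z) \<le> 2 / real k"
            using k norm_le_hsphere[OF sk_param_in_hsphere] by (auto simp: K_def)
          also have "\<dots> \<le> 2 / real (Suc N)" using that k by (intro divide_left_mono) auto
          finally show ?thesis using z by (auto simp: A_def)
        qed
        then have "z \<in> S \<times> cball 0 (2 / real (Suc N)) \<union> (\<Union>k\<in>{1..N}. K k)" for N
          using k by (cases "k \<le> N") auto
        then show "z \<in> ?B" by blast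
      next
        fix z assume z: "z \<in> ?B"
        have zN: "z \<in> S \<times> cball 0 (2 / real (Suc N)) \<or> (\<exists>k\<ge>1. z \<in> K k)" for N
          using z by auto
        have "fst z \<in> S"
        proof (cases "z \<in> A")
          case False
          then show ?thesis using zN[of 0] KA by (metis SigmaE fst_conv subsetD)
        qed (auto simp: A_def)
        then obtain s p where sp: "z = (s, p)" "s \<in> S" by (cases z) auto
        show "z \<in> A"
        proof (cases "p = 0")
          case True
          have "(0::real^('n option)) \<in> hawaiian"
            using sk_param_in_hawaiian[of 1 "0::real^'n"] sk_param_cube_bd[OF zero_in_cube_bd] by (metis order_refl)
          then show ?thesis using sp True \<open>y \<in> C\<close> by (simp add: A_def)
        next
          case False
          obtain N where "inverse (real (Suc N)) < norm p / 2"
            using False reals_Archimedean[of "norm p / 2"] by auto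
          then have "2 / real (Suc N) < norm p" by (simp add: field_simps)
          then have "z \<notin> S \<times> cball 0 (2 / real (Suc N))" using sp by auto
          then obtain k where "k \<ge> 1" "z \<in> K k" using zN[of N] by blast
          then show ?thesis using KA by blast
        qed
      qed
      moreover have "closed ?B"
        using S cKN by (intro closed_INT ballI closed_Un closed_Times) (auto intro: compact_imp_closed)
      ultimately show ?thesis by simp
    qed
    moreover have "A \<subseteq> S \<times> hawaiian" by (auto simp: A_def)
    ultimately show ?thesis
      unfolding A_def by (intro closed_subset)
  qed
  moreover have "?G (s, p) \<in> topspace Y" if sp: "s \<in> S" "p \<in> hawaiian" for s p
  proof -
    obtain k and t :: "real^'n" where "k \<ge> 1" "t \<in> cbox 0 1" "p = sk_param k t"
      using sp(2) by (rule hawaiian_cases)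
    then show ?thesis
      using G sp(1) continuous_map_image_subset_topspace[OF F[of k]] by (auto simp: image_subset_iff)
  qed
  ultimately show ?thesis
    unfolding continuous_map_closedin by auto
qed

section \<open>Homotopies of cube maps and of maps on the earring\<close>

text \<open>Since \<open>B\<close> lies in \<open>S\<close>, the relative condition sees only values
  on \<open>S\<close>, so the ends of the homotopy have to agree with \<open>f\<close> and
  \<open>g\<close> on \<open>S\<close> only.\<close>

lemma homotopic_rel_iff:
  assumes "B \<subseteq> S"
  shows "homotopic_with (\<lambda>h. \<forall>t\<in>B. h t = y) (top_of_set S) Y f g \<longleftrightarrow>
    (\<exists>H. continuous_map (top_of_set ({0..1::real} \<times> S)) Y H \<and> (\<forall>t\<in>S. H (0, t) = f t) \<and>
         (\<forall>t\<in>S. H (1, t) = g t) \<and> (\<forall>s\<in>{0..1}. \<forall>t\<in>B. H (s, t) = y))"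
proof -
  have "prod_topology (top_of_set {0..1::real}) (top_of_set S) = top_of_set ({0..1} \<times> S)"
    by simp
  then show ?thesis
    using assms by (subst homotopic_with) (fastforce, simp)
qed

abbreviation cube_homotopic :: "'b topology \<Rightarrow> 'b \<Rightarrow> (real^'n::finite \<Rightarrow> 'b) \<Rightarrow> (real^'n \<Rightarrow> 'b) \<Rightarrow> bool" where
  "cube_homotopic Y y \<equiv> homotopic_with (\<lambda>h. \<forall>t\<in>cube_bd. h t = y) (top_of_set (cbox 0 1)) Y"

abbreviation hw_homotopic ::
  "'b topology \<Rightarrow> 'b \<Rightarrow> (real^('n::finite option) \<Rightarrow> 'b) \<Rightarrow> (real^('n option) \<Rightarrow> 'b) \<Rightarrow> bool" where
  "hw_homotopic Y y \<equiv> homotopic_with (\<lambda>h. h 0 = y) (top_of_set hawaiian) Y"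

lemma zero_in_hawaiian: "(0::real^('n::finite option)) \<in> hawaiian"
proof -
  have "sk_param 1 (0::real^'n) = 0" by (rule sk_param_cube_bd) (rule zero_in_cube_bd)
  then show ?thesis using sk_param_in_hawaiian[of 1 "0::real^'n"] by simp
qed

lemmas cube_homotopic_iff = homotopic_rel_iff[OF cube_bd_subset]

lemma hw_homotopic_iff:
  "hw_homotopic Y y f g \<longleftrightarrow>
    (\<exists>H. continuous_map (top_of_set ({0..1::real} \<times> hawaiian)) Y H \<and> (\<forall>p\<in>hawaiian. H (0, p) = f p) \<and>
         (\<forall>p\<in>hawaiian. H (1, p) = g p) \<and> (\<forall>s\<in>{0..1}. H (s, 0) = y))"
  using homotopic_rel_iff[of "{0}" hawaiian y Y f g] zero_in_hawaiian by simp

section \<open>Homotopy classes of cube maps\<close>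

lemma pi_maps_cong:
  assumes "f \<in> pi_maps Y y" "\<And>t. t \<in> cbox 0 1 \<Longrightarrow> g t = f t"
  shows "g \<in> pi_maps Y y"
  using assms cube_bd_subset continuous_map_eq[of "top_of_set (cbox 0 1)" Y f g]
  by (auto simp: pi_maps_def subset_iff)

lemma cube_homotopic_refl: "f \<in> pi_maps Y y \<Longrightarrow> cube_homotopic Y y f f"
  by (simp add: pi_maps_def)

lemma cube_homotopic_eq:
  assumes "f \<in> pi_maps Y y" "\<And>t. t \<in> cbox 0 1 \<Longrightarrow> f t = g t"
  shows "cube_homotopic Y y f g"
  using assms pi_maps_cong[of f Y y g] by (intro homotopic_with_equal) (auto simp: pi_maps_def)

lemma cube_homotopic_imp_pi_maps:
  assumes "cube_homotopic Y y f g"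
  shows "f \<in> pi_maps Y y" "g \<in> pi_maps Y y"
  using homotopic_with_imp_continuous_maps[OF assms] homotopic_with_imp_property[OF assms]
  by (auto simp: pi_maps_def)

lemma mem_pi_class_iff: "g \<in> pi_class Y y f \<longleftrightarrow> cube_homotopic Y y f g"
  by (auto simp: pi_class_def dest: cube_homotopic_imp_pi_maps)

text \<open>The hypothesis excludes functions outside \<open>pi_maps\<close>, whose classes are all
  empty.\<close>

lemma pi_class_eq_iff:
  assumes "f \<in> pi_maps Y y"
  shows "pi_class Y y f = pi_class Y y g \<longleftrightarrow> cube_homotopic Y y f g"
proof
  assume "pi_class Y y f = pi_class Y y g"
  moreover have "f \<in> pi_class Y y f" using assms by (simp only: mem_pi_class_iff cube_homotopic_refl)
  ultimately have "cube_homotopic Y y g f" by (simp only: mem_pi_class_iff)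
  then show "cube_homotopic Y y f g" by (rule homotopic_with_symD)
next
  assume fg: "cube_homotopic Y y f g"
  have "cube_homotopic Y y f h \<longleftrightarrow> cube_homotopic Y y g h" for h
    using homotopic_with_trans[OF fg] homotopic_with_trans[OF homotopic_with_symD[OF fg]] by (rule iffI[rotated])
  then show "pi_class Y y f = pi_class Y y g"
    unfolding set_eq_iff mem_pi_class_iff by (rule allI)
qed

text \<open>The group operation works with chosen representatives; this compares the choice with a
  given one.\<close>

lemma pi_class_SOME:
  assumes "f \<in> pi_maps Y y"
  shows "cube_homotopic Y y f (SOME g. g \<in> pi_class Y y f)"
proof -
  have "f \<in> pi_class Y y f" using assms by (simp only: mem_pi_class_iff cube_homotopic_refl)
  then have "(SOME g. g \<in> pi_class Y y f) \<in> pi_class Y y f"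
    by (rule someI[of "\<lambda>g. g \<in> pi_class Y y f"])
  then show ?thesis by (rule mem_pi_class_iff[THEN iffD1])
qed

section \<open>Homotopy classes of maps on the earring\<close>

lemma hw_homotopic_imp_hw_maps:
  assumes "hw_homotopic Y y f g"
  shows "f \<in> hw_maps Y y" "g \<in> hw_maps Y y"
  using homotopic_with_imp_continuous_maps[OF assms] homotopic_with_imp_property[OF assms]
  by (auto simp: hw_maps_def)

lemma hw_homotopic_refl: "f \<in> hw_maps Y y \<Longrightarrow> hw_homotopic Y y f f"
  by (simp add: hw_maps_def)

lemma mem_hw_class_iff: "g \<in> hw_class Y y f \<longleftrightarrow> hw_homotopic Y y f g"
  by (auto simp: hw_class_def dest: hw_homotopic_imp_hw_maps)

lemma hw_class_eqI:
  assumes fg: "hw_homotopic Y y f g"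
  shows "hw_class Y y f = hw_class Y y g"
proof -
  have "hw_homotopic Y y f h \<longleftrightarrow> hw_homotopic Y y g h" for h
    using homotopic_with_trans[OF fg] homotopic_with_trans[OF homotopic_with_symD[OF fg]] by (rule iffI[rotated])
  then show ?thesis
    unfolding set_eq_iff mem_hw_class_iff by (rule allI)
qed

lemma hw_class_SOME:
  assumes "f \<in> hw_maps Y y"
  shows "hw_homotopic Y y f (SOME g. g \<in> hw_class Y y f)"
proof -
  have "f \<in> hw_class Y y f" using assms by (simp only: mem_hw_class_iff hw_homotopic_refl)
  then have "(SOME g. g \<in> hw_class Y y f) \<in> hw_class Y y f"
    by (rule someI[of "\<lambda>g. g \<in> hw_class Y y f"])
  then show ?thesis by (rule mem_hw_class_iff[THEN iffD1])
qed

section \<open>Concatenation\<close>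

text \<open>Covers the rescalings of both halves of \<open>cube_concat\<close>; the first factor
  carries the homotopy parameter along.\<close>

lemma continuous_on_replace_coordinate:
  fixes S :: "('c::topological_space \<times> (real^'n::finite)) set"
  shows "continuous_on S (\<lambda>z. (fst z, \<chi> i. if i = j then a * (snd z)$j + b else (snd z)$i))"
proof -
  have "continuous_on S (\<lambda>z. \<chi> i. if i = j then a * (snd z)$j + b else (snd z)$i)"
  proof (rule continuous_on_vec_lambda)
    have nth: "continuous_on S (\<lambda>z. (snd z)$i)" for i :: 'n
      by (intro continuous_on_component continuous_on_snd continuous_on_id)
    then have "continuous_on S (\<lambda>z. a * (snd z)$j + b)"
      by (intro continuous_intros)
    with nth show "continuous_on S (\<lambda>z. if i = j then a * (snd z)$j + b else (snd z)$i)" for i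
      by (cases "i = j") simp_all
  qed
  then show ?thesis
    by (intro continuous_on_Pair continuous_on_fst continuous_on_id)
qed

text \<open>The two halves are pasted along the middle hyperplane, where the rescaled points lie on
  opposite faces of the cube and both values are \<open>y\<close>.\<close>

lemma continuous_map_cube_concat:
  fixes H1 H2 :: "'c::topological_space \<times> (real^'n::finite) \<Rightarrow> 'b"
  assumes H: "continuous_map (top_of_set (S \<times> cbox 0 1)) Y H1" "continuous_map (top_of_set (S \<times> cbox 0 1)) Y H2"
    and bd: "\<And>s t. s \<in> S \<Longrightarrow> t \<in> cube_bd \<Longrightarrow> H1 (s, t) = y" "\<And>s t. s \<in> S \<Longrightarrow> t \<in> cube_bd \<Longrightarrow> H2 (s, t) = y"
  shows "continuous_map (top_of_set (S \<times> cbox 0 1)) Y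
           (\<lambda>(s, t). cube_concat (\<lambda>t. H1 (s, t)) (\<lambda>t. H2 (s, t)) t)"
proof -
  let ?D = "S \<times> cbox 0 (1::real^'n)"
  let ?lo = "\<lambda>z::'c \<times> (real^'n). (fst z, \<chi> i. if i = c0 then 2 * (snd z)$c0 else (snd z)$i)"
  let ?hi = "\<lambda>z::'c \<times> (real^'n). (fst z, \<chi> i. if i = c0 then 2 * (snd z)$c0 - 1 else (snd z)$i)"
  have "continuous_map (top_of_set ?D) Y (\<lambda>z. if (snd z)$c0 \<le> 1/2 then (H1 \<circ> ?lo) z else (H2 \<circ> ?hi) z)"
  proof (rule continuous_map_cases_le)
    show "continuous_map (top_of_set ?D) euclideanreal (\<lambda>z. (snd z)$c0)"
      by (auto intro!: continuous_intros)
    show "continuous_map (subtopology (top_of_set ?D) {z \<in> topspace (top_of_set ?D). (snd z)$c0 \<le> 1/2}) Y (H1 \<circ> ?lo)"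
    proof (rule continuous_map_compose[OF _ H(1)])
      have "continuous_on {z \<in> ?D. (snd z)$c0 \<le> 1/2} ?lo"
        using continuous_on_replace_coordinate[of "{z \<in> ?D. (snd z)$c0 \<le> 1/2}" c0 2 0] by (simp cong: if_cong)
      then show "continuous_map (subtopology (top_of_set ?D) {z \<in> topspace (top_of_set ?D). (snd z)$c0 \<le> 1/2}) (top_of_set ?D) ?lo"
        by (auto simp: subtopology_subtopology mem_box_cart Int_def continuous_map_in_subtopology)
    qed
    show "continuous_map (subtopology (top_of_set ?D) {z \<in> topspace (top_of_set ?D). 1/2 \<le> (snd z)$c0}) Y (H2 \<circ> ?hi)"
    proof (rule continuous_map_compose[OF _ H(2)])
      have "continuous_on {z \<in> ?D. 1/2 \<le> (snd z)$c0} ?hi"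
        using continuous_on_replace_coordinate[of "{z \<in> ?D. 1/2 \<le> (snd z)$c0}" c0 2 "-1"] by (simp cong: if_cong)
      then show "continuous_map (subtopology (top_of_set ?D) {z \<in> topspace (top_of_set ?D). 1/2 \<le> (snd z)$c0}) (top_of_set ?D) ?hi"
        by (auto simp: subtopology_subtopology mem_box_cart Int_def continuous_map_in_subtopology)
    qed
    show "(H1 \<circ> ?lo) z = (H2 \<circ> ?hi) z" if z: "z \<in> topspace (top_of_set ?D)" "(snd z)$c0 = 1/2" for z
    proof -
      have "snd (?lo z) \<in> cube_bd" "snd (?hi z) \<in> cube_bd"
        using z by (auto simp: mem_cube_bd_iff mem_box_cart intro!: exI[of _ c0])
      then show ?thesis using z bd by auto
    qed
  qed simp
  then show ?thesis
    by (simp add: case_prod_unfold cube_concat_def o_def cong: if_cong)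
qed

text \<open>A coordinate equal to 0 or 1 keeps that value under the rescaling of the half in which
  the point lies.\<close>

lemma cube_concat_bd:
  assumes "\<And>t. t \<in> cube_bd \<Longrightarrow> f t = y" "\<And>t. t \<in> cube_bd \<Longrightarrow> g t = y" "t \<in> cube_bd"
  shows "cube_concat f g t = y"
proof -
  have t: "\<And>i. 0 \<le> t$i \<and> t$i \<le> 1" and "\<exists>j. t$j = 0 \<or> t$j = 1"
    using assms(3) by (auto simp: mem_cube_bd_iff mem_box_cart)
  then obtain j where j: "t$j = 0 \<or> t$j = 1" by blast
  have "(\<chi> i. if i = c0 then 2 * t$c0 else t$i) \<in> cube_bd" if "t$c0 \<le> 1/2"
    using t j that by (auto simp: mem_cube_bd_iff mem_box_cart intro!: exI[of _ j])
  moreover have "(\<chi> i. if i = c0 then 2 * t$c0 - 1 else t$i) \<in> cube_bd" if "\<not> t$c0 \<le> 1/2"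
    using t j that by (auto simp: mem_cube_bd_iff mem_box_cart intro!: exI[of _ j])
  ultimately show ?thesis using assms(1,2) by (simp add: cube_concat_def)
qed

lemma cube_concat_image:
  assumes "t \<in> cbox 0 1"
  shows "cube_concat f g t \<in> f ` cbox 0 1 \<union> g ` cbox 0 1"
proof -
  have t: "\<And>i. 0 \<le> t$i \<and> t$i \<le> 1" using assms by (auto simp: mem_box_cart)
  have "(\<chi> i. if i = c0 then 2 * t$c0 else t$i) \<in> cbox 0 1" if "t$c0 \<le> 1/2"
    using t that by (auto simp: mem_box_cart)
  moreover have "(\<chi> i. if i = c0 then 2 * t$c0 - 1 else t$i) \<in> cbox 0 1" if "\<not> t$c0 \<le> 1/2"
    using t that by (auto simp: mem_box_cart)
  ultimately show ?thesis by (simp add: cube_concat_def)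
qed

lemma cube_homotopic_concat:
  fixes f g :: "real^'n::finite \<Rightarrow> 'b"
  assumes "cube_homotopic Y y f f'" "cube_homotopic Y y g g'"
  shows "cube_homotopic Y y (cube_concat f g) (cube_concat f' g')"
proof -
  obtain H1 where H1: "continuous_map (top_of_set ({0..1::real} \<times> cbox 0 1)) Y H1"
      "\<And>t. t \<in> cbox 0 1 \<Longrightarrow> H1 (0, t) = f t" "\<And>t. t \<in> cbox 0 1 \<Longrightarrow> H1 (1, t) = f' t"
      "\<And>s t. s \<in> {0..1} \<Longrightarrow> t \<in> cube_bd \<Longrightarrow> H1 (s, t) = y"
    using assms(1) unfolding cube_homotopic_iff by blast
  obtain H2 where H2: "continuous_map (top_of_set ({0..1::real} \<times> cbox 0 1)) Y H2"
      "\<And>t. t \<in> cbox 0 1 \<Longrightarrow> H2 (0, t) = g t" "\<And>t. t \<in> cbox 0 1 \<Longrightarrow> H2 (1, t) = g' t"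
      "\<And>s t. s \<in> {0..1} \<Longrightarrow> t \<in> cube_bd \<Longrightarrow> H2 (s, t) = y"
    using assms(2) unfolding cube_homotopic_iff by blast
  \<comment> \<open>The homotopies match the given maps on the cube only, which suffices because the
    rescaled points stay in the cube.\<close>
  have cong: "cube_concat u v t = cube_concat u' v' t"
    if "t \<in> cbox 0 1" "\<And>t. t \<in> cbox 0 1 \<Longrightarrow> u t = u' t" "\<And>t. t \<in> cbox 0 1 \<Longrightarrow> v t = v' t"
    for u v u' v' :: "real^'n \<Rightarrow> 'b" and t
    using that by (auto simp: cube_concat_def mem_box_cart)
  let ?H = "\<lambda>(s, t). cube_concat (\<lambda>t. H1 (s, t)) (\<lambda>t. H2 (s, t)) t"
  have "continuous_map (top_of_set ({0..1::real} \<times> cbox 0 1)) Y ?H"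
    using H1 H2 by (intro continuous_map_cube_concat) auto
  moreover have "\<forall>t\<in>cbox 0 1. ?H (0, t) = cube_concat f g t"
    using H1(2) H2(2) by (auto intro!: cong)
  moreover have "\<forall>t\<in>cbox 0 1. ?H (1, t) = cube_concat f' g' t"
    using H1(3) H2(3) by (auto intro!: cong)
  moreover have "\<forall>s\<in>{0..1}. \<forall>t\<in>cube_bd. ?H (s, t) = y"
    using H1(4) H2(4) by (auto intro!: cube_concat_bd)
  ultimately show ?thesis
    unfolding cube_homotopic_iff by blast
qed

text \<open>Continuity is read off from the concatenation of constant homotopies.\<close>

lemma cube_concat_pi_maps:
  assumes "f \<in> pi_maps Y y" "g \<in> pi_maps Y y"
  shows "cube_concat f g \<in> pi_maps Y y"
proof -
  have "cube_homotopic Y y (cube_concat f g) (cube_concat f g)"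
    using assms by (intro cube_homotopic_concat cube_homotopic_refl)
  then show ?thesis by (rule cube_homotopic_imp_pi_maps)
qed

lemma null_convergent_cube_concat:
  assumes "null_convergent Y y f" "null_convergent Y y g"
  shows "null_convergent Y y (\<lambda>i. cube_concat (f i) (g i))"
  unfolding null_convergent_def
proof (intro allI impI)
  fix U assume "openin Y U \<and> y \<in> U"
  then have "\<forall>\<^sub>F i in sequentially. f i ` cbox 0 1 \<subseteq> U" "\<forall>\<^sub>F i in sequentially. g i ` cbox 0 1 \<subseteq> U"
    using assms by (auto simp: null_convergent_def)
  then show "\<forall>\<^sub>F i in sequentially. cube_concat (f i) (g i) ` cbox 0 1 \<subseteq> U"
  proof (rule eventually_elim2)
    fix i assume "f i ` cbox 0 1 \<subseteq> U" "g i ` cbox 0 1 \<subseteq> U"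
    then have "f i ` cbox 0 1 \<union> g i ` cbox 0 1 \<subseteq> U" by blast
    then show "cube_concat (f i) (g i) ` cbox 0 1 \<subseteq> U"
      using cube_concat_image by (intro image_subsetI) (rule subsetD)
  qed
qed

section \<open>Maps on the earring and null-convergent families\<close>

lemma continuous_map_sk_param:
  "k \<ge> 1 \<Longrightarrow> continuous_map (top_of_set (cbox 0 1)) (top_of_set hawaiian) (sk_param k)"
  using sk_param_in_hawaiian by (auto intro: continuous_on_sk_param)

lemma hw_maps_sk_param:
  assumes "f \<in> hw_maps Y y" "k \<ge> 1"
  shows "f \<circ> sk_param k \<in> pi_maps Y y"
  using assms(1) continuous_map_compose[OF continuous_map_sk_param[OF assms(2)], of Y f]
  by (simp add: hw_maps_def pi_maps_def sk_param_cube_bd)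

lemma hw_homotopic_sk_param:
  assumes "hw_homotopic Y y f g" "k \<ge> 1"
  shows "cube_homotopic Y y (f \<circ> sk_param k) (g \<circ> sk_param k)"
proof (rule homotopic_with_compose_continuous_map_right[OF assms(1)])
  show "continuous_map (top_of_set (cbox 0 1)) (top_of_set hawaiian) (sk_param k)"
    using assms(2) by (rule continuous_map_sk_param)
qed (simp add: sk_param_cube_bd)

text \<open>Continuity at the base point, since the spheres with large index lie in any given ball
  around it. \<open>Suc i\<close> appears because spheres are counted from 1 and sequences from
  0.\<close>

lemma null_convergent_sk_param:
  assumes f: "f \<in> hw_maps Y y"
  shows "null_convergent Y y (\<lambda>i. f \<circ> sk_param (Suc i))"
  unfolding null_convergent_def
proof (intro allI impI)
  fix U assume U: "openin Y U \<and> y \<in> U"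
  have "openin (top_of_set hawaiian) {p \<in> topspace (top_of_set hawaiian). f p \<in> U}"
    using f U unfolding hw_maps_def by (intro openin_continuous_map_preimage) auto
  moreover have "0 \<in> {p \<in> topspace (top_of_set hawaiian). f p \<in> U}"
    using f U zero_in_hawaiian by (simp add: hw_maps_def)
  ultimately obtain e where e: "e > 0" "ball 0 e \<inter> hawaiian \<subseteq> {p \<in> hawaiian. f p \<in> U}"
    unfolding openin_contains_ball by force
  obtain N where N: "inverse (real (Suc N)) < e / 2"
    using reals_Archimedean[of "e / 2"] e by auto
  have "f (sk_param (Suc i) t) \<in> U" if "i \<ge> N" for i t
  proof -
    have "norm (sk_param (Suc i) t) \<le> 2 / real (Suc i)"
      by (intro norm_le_hsphere sk_param_in_hsphere) simp
    also have "\<dots> \<le> 2 / real (Suc N)" using that by (intro divide_left_mono) auto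
    also have "\<dots> < e" using N by (simp add: field_simps)
    finally show ?thesis
      using e sk_param_in_hawaiian[of "Suc i" t] by auto
  qed
  then show "\<forall>\<^sub>F i in sequentially. (f \<circ> sk_param (Suc i)) ` cbox 0 1 \<subseteq> U"
    unfolding eventually_sequentially by (intro exI[of _ N]) auto
qed

lemma null_convergent_imp_hw_map:
  fixes F :: "nat \<Rightarrow> real^'n::finite \<Rightarrow> 'b"
  assumes F: "\<And>i. F i \<in> pi_maps Y y" and null: "null_convergent Y y F"
  shows "hw_glue y (\<lambda>k. F (k - 1)) \<in> hw_maps Y y"
proof -
  \<comment> \<open>A one-point parameter space turns the parametrised gluing into gluing of maps;
    \<open>k - 1\<close> undoes the shift of indices.\<close>
  have cont: "continuous_map (top_of_set ({0::real} \<times> hawaiian)) Y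
     (\<lambda>(s, p). hw_glue y (\<lambda>k t. (\<lambda>z. F (k - 1) (snd z)) (s, t)) p)"
  proof (rule continuous_map_hw_glue)
    show "continuous_map (top_of_set ({0::real} \<times> cbox 0 1)) Y (\<lambda>z. F (k - 1) (snd z))" for k
    proof -
      have "continuous_map (top_of_set ({0::real} \<times> cbox 0 1)) (top_of_set (cbox 0 1)) (snd :: _ \<Rightarrow> real^'n)"
        by (auto intro!: continuous_intros)
      moreover have "continuous_map (top_of_set (cbox 0 1)) Y (F (k - 1))"
        using F[of "k - 1"] by (simp add: pi_maps_def)
      ultimately have "continuous_map (top_of_set ({0::real} \<times> cbox 0 1)) Y (F (k - 1) \<circ> snd)"
        by (rule continuous_map_compose)
      then show ?thesis by (simp only: o_def)
    qed
    show "\<exists>N. \<forall>k\<ge>N. (\<lambda>z. F (k - 1) (snd z)) ` ({0::real} \<times> cbox 0 1) \<subseteq> U"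
      if U: "openin Y U" "y \<in> U" for U
    proof -
      obtain N where N: "\<And>i. i \<ge> N \<Longrightarrow> F i ` cbox 0 1 \<subseteq> U"
        using null U unfolding null_convergent_def eventually_sequentially by blast
      have "(\<lambda>z. F (k - 1) (snd z)) ` ({0::real} \<times> cbox 0 1) \<subseteq> U" if "k \<ge> Suc N" for k
        using N[of "k - 1"] that by force
      then show ?thesis by blast
    qed
  qed (use F in \<open>auto simp: pi_maps_def\<close>)
  have "continuous_map (top_of_set hawaiian) (top_of_set ({0::real} \<times> hawaiian)) (\<lambda>p. (0, p))"
    by (auto intro!: continuous_intros)
  from continuous_map_compose[OF this cont] show ?thesis
    by (simp add: hw_maps_def o_def)
qed

text \<open>Here the interval is the parameter space. The premise \<open>null\<close> is what
  unrelated homotopies on the single spheres may lack, and continuity at the base point rests on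
  it.\<close>

lemma hw_homotopicI:
  fixes H :: "nat \<Rightarrow> real \<times> (real^'n::finite) \<Rightarrow> 'b"
  assumes fg: "f \<in> hw_maps Y y" "g \<in> hw_maps Y y"
    and H: "\<And>k. k \<ge> 1 \<Longrightarrow> continuous_map (top_of_set ({0..1::real} \<times> cbox 0 1)) Y (H k)"
    and H0: "\<And>k t. k \<ge> 1 \<Longrightarrow> t \<in> cbox 0 1 \<Longrightarrow> H k (0, t) = f (sk_param k t)"
    and H1: "\<And>k t. k \<ge> 1 \<Longrightarrow> t \<in> cbox 0 1 \<Longrightarrow> H k (1, t) = g (sk_param k t)"
    and bd: "\<And>k s t. k \<ge> 1 \<Longrightarrow> s \<in> {0..1} \<Longrightarrow> t \<in> cube_bd \<Longrightarrow> H k (s, t) = y"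
    and null: "\<And>U. openin Y U \<Longrightarrow> y \<in> U \<Longrightarrow> \<exists>N. \<forall>k\<ge>N. H k ` ({0..1} \<times> cbox 0 1) \<subseteq> U"
  shows "hw_homotopic Y y f g"
proof -
  let ?G = "\<lambda>(s, p). hw_glue y (\<lambda>k t. H k (s, t)) p"
  have G: "?G (s, sk_param k t) = H k (s, t)" if "s \<in> {0..1}" "k \<ge> 1" "t \<in> cbox 0 1" for s k t
  proof -
    have "?G (s, sk_param k t) = hw_glue y (\<lambda>k t. H k (s, t)) (sk_param k t)" by simp
    also have "\<dots> = H k (s, t)" using that bd by (intro hw_glue_sk_param) auto
    finally show ?thesis .
  qed
  have "continuous_map (top_of_set ({0..1} \<times> hawaiian)) Y ?G"
    using H bd null by (intro continuous_map_hw_glue) auto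
  moreover have "?G (0, p) = f p" "?G (1, p) = g p" if p: "p \<in> hawaiian" for p
  proof -
    obtain k and t :: "real^'n" where "k \<ge> 1" "t \<in> cbox 0 1" "p = sk_param k t"
      using p by (rule hawaiian_cases)
    then show "?G (0, p) = f p" "?G (1, p) = g p"
      using G[of 0 k t] G[of 1 k t] H0 H1 by auto
  qed
  ultimately show ?thesis
    unfolding hw_homotopic_iff by (intro exI[of _ ?G]) auto
qed

text \<open>The index chosen by \<open>hw_glue\<close> at a point of the earring other than
  \<open>0\<close> is at least 1, so \<open>Suc (k - 1)\<close> may replace
  \<open>k\<close>.\<close>

lemma hw_glue_cong:
  assumes "\<And>k. k \<ge> 1 \<Longrightarrow> F k = G k"
  shows "hw_glue y F = hw_glue y G"
proof
  fix p
  show "hw_glue y F p = hw_glue y G p"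
  proof (cases "p \<in> hawaiian - {0}")
    case True
    then have "\<exists>k. 1 \<le> k \<and> p \<in> hsphere k" by (auto simp: hawaiian_def)
    then have "1 \<le> (SOME k. 1 \<le> k \<and> p \<in> hsphere k)" by (rule someI2_ex) blast
    then show ?thesis by (simp only: hw_glue_def Let_def assms)
  qed (auto simp: hw_glue_def)
qed

lemma hw_concat_hw_maps:
  assumes "f \<in> hw_maps Y y" "g \<in> hw_maps Y y"
  shows "hw_concat y f g \<in> hw_maps Y y"
proof -
  let ?F = "\<lambda>i. cube_concat (f \<circ> sk_param (Suc i)) (g \<circ> sk_param (Suc i))"
  have "hw_glue y (\<lambda>k. ?F (k - 1)) \<in> hw_maps Y y"
    using assms
    by (intro null_convergent_imp_hw_map cube_concat_pi_maps hw_maps_sk_param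
        null_convergent_cube_concat null_convergent_sk_param) auto
  moreover have "hw_glue y (\<lambda>k. ?F (k - 1)) = hw_concat y f g"
    unfolding hw_concat_eq_glue by (rule hw_glue_cong) simp
  ultimately show ?thesis by simp
qed

lemma hw_concat_sk_param:
  assumes "f \<in> hw_maps Y y" "g \<in> hw_maps Y y" "k \<ge> 1" "t \<in> cbox 0 1"
  shows "hw_concat y f g (sk_param k t) = cube_concat (f \<circ> sk_param k) (g \<circ> sk_param k) t"
proof -
  have "cube_concat (f \<circ> sk_param k) (g \<circ> sk_param k) \<in> pi_maps Y y"
    using assms by (intro cube_concat_pi_maps hw_maps_sk_param)
  then show ?thesis
    unfolding hw_concat_eq_glue using assms by (subst hw_glue_sk_param) (auto simp: pi_maps_def)
qed

lemma homotopy_group_mult: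
  assumes "f \<in> pi_maps Y y" "g \<in> pi_maps Y y"
  shows "pi_class Y y f \<otimes>\<^bsub>homotopy_group Y y\<^esub> pi_class Y y g = pi_class Y y (cube_concat f g)"
proof -
  have "cube_homotopic Y y (cube_concat f g)
          (cube_concat (SOME h. h \<in> pi_class Y y f) (SOME h. h \<in> pi_class Y y g))"
    using assms by (intro cube_homotopic_concat pi_class_SOME)
  then have "pi_class Y y (cube_concat f g) =
      pi_class Y y (cube_concat (SOME h. h \<in> pi_class Y y f) (SOME h. h \<in> pi_class Y y g))"
    using assms by (intro pi_class_eq_iff[THEN iffD2] cube_concat_pi_maps)
  then show ?thesis by (simp add: homotopy_group_def)
qed

text \<open>The given homotopy may leave \<open>V\<close> and \<open>W\<close>, but \<open>r\<close>
  maps all of \<open>Y\<close> into \<open>W\<close>. Only the ends have to lie in \<open>V\<close>,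
  where \<open>hom\<close> joins them to their composites with \<open>r\<close>.\<close>

lemma cube_homotopic_into_nbhd:
  assumes r: "continuous_map Y (subtopology Y W) r"
    and hom: "homotopic_with (\<lambda>h. h y = y) (subtopology Y V) (subtopology Y W) id r"
    and fg: "cube_homotopic Y y f g" and V: "f ` cbox 0 1 \<subseteq> V" "g ` cbox 0 1 \<subseteq> V"
  shows "cube_homotopic (subtopology Y W) y f g"
proof -
  have ry: "r y = y" using homotopic_with_imp_property[OF hom] by simp
  have to_r: "cube_homotopic (subtopology Y W) y f (r \<circ> f)"
    if "f \<in> pi_maps Y y" "f ` cbox 0 1 \<subseteq> V" for f
  proof -
    have "continuous_map (top_of_set (cbox 0 1)) (subtopology Y V) f"
      using that by (auto simp: pi_maps_def continuous_map_in_subtopology)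
    then have "cube_homotopic (subtopology Y W) y (id \<circ> f) (r \<circ> f)"
      by (rule homotopic_with_compose_continuous_map_right[OF hom]) (use that in \<open>simp add: pi_maps_def\<close>)
    then show ?thesis by simp
  qed
  have "cube_homotopic (subtopology Y W) y (r \<circ> f) (r \<circ> g)"
    by (rule homotopic_with_compose_continuous_map_left[OF fg r]) (simp add: ry)
  moreover have "cube_homotopic (subtopology Y W) y f (r \<circ> f)" "cube_homotopic (subtopology Y W) y g (r \<circ> g)"
    using cube_homotopic_imp_pi_maps[OF fg] V by (auto intro!: to_r)
  ultimately show ?thesis
    by (meson homotopic_with_symD homotopic_with_trans)
qed

text \<open>For each \<open>k\<close> the homotopy is placed in \<open>W m\<close> for the largest
  \<open>m <= k\<close> such that both restrictions lie in \<open>V m\<close>, if there is one.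
  Every \<open>V N\<close> contains almost all restrictions, so this \<open>m\<close> tends to
  infinity with \<open>k\<close> and the homotopies are null-convergent.\<close>

lemma hw_homotopic_if_cube_homotopic:
  fixes f g :: "real^('n::finite option) \<Rightarrow> 'b" and V W :: "nat \<Rightarrow> 'b set"
  assumes V: "\<And>m. openin Y (V m)" "\<And>m. y \<in> V m"
    and W: "\<And>U. openin Y U \<Longrightarrow> y \<in> U \<Longrightarrow> \<exists>N. \<forall>m\<ge>N. W m \<subseteq> U"
    and r: "\<And>m. continuous_map Y (subtopology Y (W m)) (r m)"
    and hom: "\<And>m. homotopic_with (\<lambda>h. h y = y) (subtopology Y (V m)) (subtopology Y (W m)) id (r m)"
    and fg: "f \<in> hw_maps Y y" "g \<in> hw_maps Y y"
    and cube: "\<And>k. k \<ge> 1 \<Longrightarrow> cube_homotopic Y y (f \<circ> sk_param k) (g \<circ> sk_param k :: real^'n \<Rightarrow> 'b)"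
  shows "hw_homotopic Y y f g"
proof -
  define fits :: "nat \<Rightarrow> nat \<Rightarrow> bool" where
    "fits k m \<longleftrightarrow> (f \<circ> sk_param k) ` cbox 0 (1::real^'n) \<subseteq> V m \<and> (g \<circ> sk_param k) ` cbox 0 (1::real^'n) \<subseteq> V m" for k m
  \<comment> \<open>The last conjunct speaks of some \<open>m >= N\<close> because the sets
    \<open>W m\<close> are not assumed to be nested.\<close>
  define P where "P k H \<longleftrightarrow> continuous_map (top_of_set ({0..1::real} \<times> cbox 0 (1::real^'n))) Y H \<and>
      (\<forall>t\<in>cbox 0 1. H (0, t) = f (sk_param k t)) \<and> (\<forall>t\<in>cbox 0 1. H (1, t) = g (sk_param k t)) \<and>
      (\<forall>s\<in>{0..1}. \<forall>t\<in>cube_bd. H (s, t) = y) \<and>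
      (\<forall>N\<le>k. fits k N \<longrightarrow> (\<exists>m\<ge>N. H ` ({0..1} \<times> cbox 0 1) \<subseteq> W m))" for k H
  have small: "\<exists>H. P k H" if k: "k \<ge> 1" for k
  proof (cases "\<exists>m\<le>k. fits k m")
    case False
    \<comment> \<open>With no fitting level the last conjunct of \<open>P\<close> is vacuous and the
      given homotopy is kept.\<close>
    then show ?thesis
      using cube[OF k] unfolding P_def cube_homotopic_iff by auto
  next
    case True
    \<comment> \<open>The bound \<open>m <= k\<close> keeps the set finite, so that a maximum exists
      even if all levels fit.\<close>
    define M where "M = {m. m \<le> k \<and> fits k m}"
    have M: "finite M" "M \<noteq> {}" using True by (auto simp: M_def)
    have "fits k (Max M)" using Max_in[OF M] by (simp add: M_def)
    then have "cube_homotopic (subtopology Y (W (Max M))) y (f \<circ> sk_param k) (g \<circ> sk_param k :: real^'n \<Rightarrow> 'b)"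
      using cube_homotopic_into_nbhd[OF r hom cube[OF k]] by (simp add: fits_def)
    then obtain H where H: "continuous_map (top_of_set ({0..1::real} \<times> cbox 0 (1::real^'n))) (subtopology Y (W (Max M))) H"
      "\<forall>t\<in>cbox 0 1. H (0, t) = (f \<circ> sk_param k) t" "\<forall>t\<in>cbox 0 1. H (1, t) = (g \<circ> sk_param k) t"
      "\<forall>s\<in>{0..1}. \<forall>t\<in>cube_bd. H (s, t) = y"
      unfolding cube_homotopic_iff by blast
    then have HY: "continuous_map (top_of_set ({0..1::real} \<times> cbox 0 (1::real^'n))) Y H"
      and HW: "H ` ({0..1} \<times> cbox 0 1) \<subseteq> W (Max M)"
      by (auto simp: continuous_map_in_subtopology)
    have "N \<le> Max M" if "N \<le> k" "fits k N" for N
      using that M by (intro Max_ge) (auto simp: M_def)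
    then show ?thesis using H(2-4) HY HW unfolding P_def by (intro exI[of _ H]) auto
  qed
  define H where "H k = (SOME H. P k H)" for k
  have PH: "P k (H k)" if "k \<ge> 1" for k
    unfolding H_def using small[OF that] by (rule someI_ex)
  have HW: "\<exists>m\<ge>N. H k ` ({0..1} \<times> cbox 0 1) \<subseteq> W m" if "k \<ge> 1" "N \<le> k" "fits k N" for k N
    using PH that unfolding P_def by blast
  show ?thesis
  proof (rule hw_homotopicI[OF fg, where H = H])
    fix k :: nat assume "k \<ge> 1"
    note PH[OF this, unfolded P_def]
    then show "continuous_map (top_of_set ({0..1::real} \<times> cbox 0 (1::real^'n))) Y (H k)"
      "\<And>t. t \<in> cbox 0 1 \<Longrightarrow> H k (0, t) = f (sk_param k t)"
      "\<And>t. t \<in> cbox 0 1 \<Longrightarrow> H k (1, t) = g (sk_param k t)"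
      "\<And>s t. s \<in> {0..1} \<Longrightarrow> t \<in> cube_bd \<Longrightarrow> H k (s, t) = y" by blast+
  next
    fix U assume U: "openin Y U" "y \<in> U"
    then obtain N where N: "\<And>m. m \<ge> N \<Longrightarrow> W m \<subseteq> U" using W by blast
    have "\<forall>\<^sub>F i in sequentially. fits (Suc i) N"
      using null_convergent_sk_param[OF fg(1)] null_convergent_sk_param[OF fg(2)] V[of N]
      unfolding null_convergent_def fits_def by (intro eventually_conj) auto
    then obtain N' where N': "\<And>i. i \<ge> N' \<Longrightarrow> fits (Suc i) N"
      unfolding eventually_sequentially by blast
    have "H k ` ({0..1} \<times> cbox 0 1) \<subseteq> U" if k: "k \<ge> Suc (N + N')" for k
    proof -
      have "fits k N" using N'[of "k - 1"] k by simp
      then show ?thesis using HW[of k N] k N by fastforce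
    qed
    then show "\<exists>N. \<forall>k\<ge>N. H k ` ({0..1} \<times> cbox 0 1) \<subseteq> U" by blast
  qed
qed

section \<open>The isomorphism\<close>

text \<open>A class is entered through a chosen representative, so independence of the choice has to
  be shown; the entry \<open>i\<close> belongs to the sphere with index
  \<open>Suc i\<close>.\<close>

definition hw_restrict ::
  "'b topology \<Rightarrow> 'b \<Rightarrow> (real^('n::finite option) \<Rightarrow> 'b) set \<Rightarrow> nat \<Rightarrow> (real^'n \<Rightarrow> 'b) set" where
  "hw_restrict Y y A = (\<lambda>i. pi_class Y y ((SOME f. f \<in> A) \<circ> sk_param (Suc i)))"

lemma hw_restrict_hw_class:
  assumes "f \<in> hw_maps Y y"
  shows "hw_restrict Y y (hw_class Y y f) = (\<lambda>i. pi_class Y y (f \<circ> sk_param (Suc i)))"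
proof
  fix i
  have "cube_homotopic Y y (f \<circ> sk_param (Suc i)) ((SOME g. g \<in> hw_class Y y f) \<circ> sk_param (Suc i))"
    using hw_class_SOME[OF assms] by (rule hw_homotopic_sk_param) simp
  moreover have "f \<circ> sk_param (Suc i) \<in> pi_maps Y y" using assms by (rule hw_maps_sk_param) simp
  ultimately have "pi_class Y y (f \<circ> sk_param (Suc i)) =
      pi_class Y y ((SOME g. g \<in> hw_class Y y f) \<circ> sk_param (Suc i))"
    by (simp only: pi_class_eq_iff)
  then show "hw_restrict Y y (hw_class Y y f) i = pi_class Y y (f \<circ> sk_param (Suc i))"
    by (simp only: hw_restrict_def)
qed

lemma L_group_carrierE:
  assumes "s \<in> carrier (L_group Y y)"
  obtains F where "\<And>i. F i \<in> pi_maps Y y" "\<And>i. s i = pi_class Y y (F i)" "null_convergent Y y F"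
proof -
  obtain F where F: "\<And>i. F i \<in> s i" "null_convergent Y y F"
    and s: "\<And>i. s i \<in> pi_class Y y ` pi_maps Y y"
    using assms by (auto simp: L_group_def homotopy_group_def)
  have "F i \<in> pi_maps Y y \<and> s i = pi_class Y y (F i)" for i
  proof -
    obtain h where h: "h \<in> pi_maps Y y" "s i = pi_class Y y h" using s by blast
    then have hom: "cube_homotopic Y y h (F i)" using F(1)[of i] by (simp only: mem_pi_class_iff)
    then have "pi_class Y y h = pi_class Y y (F i)" using h(1) by (simp only: pi_class_eq_iff)
    then show ?thesis using h(2) cube_homotopic_imp_pi_maps(2)[OF hom] by simp
  qed
  then show ?thesis using that F(2) by blast
qed

text \<open>Stated for any pointed space with such neighbourhoods and maps \<open>r\<close>. They
  enter through injectivity; restriction to the spheres and gluing give the rest.\<close>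

lemma hawaiian_group_iso_L_group:
  fixes Y :: "'b topology" and V W :: "nat \<Rightarrow> 'b set"
  assumes V: "\<And>m. openin Y (V m)" "\<And>m. y \<in> V m"
    and W: "\<And>U. openin Y U \<Longrightarrow> y \<in> U \<Longrightarrow> \<exists>N. \<forall>m\<ge>N. W m \<subseteq> U"
    and r: "\<And>m. continuous_map Y (subtopology Y (W m)) (r m)"
    and hom: "\<And>m. homotopic_with (\<lambda>h. h y = y) (subtopology Y (V m)) (subtopology Y (W m)) id (r m)"
  shows "(hawaiian_group Y y :: ((real^('n::finite option) \<Rightarrow> 'b) set) monoid)
           \<cong> (L_group Y y :: (nat \<Rightarrow> (real^'n \<Rightarrow> 'b) set) monoid)"
proof -
  let ?G = "hawaiian_group Y y :: ((real^('n option) \<Rightarrow> 'b) set) monoid"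
  let ?L = "L_group Y y :: (nat \<Rightarrow> (real^'n \<Rightarrow> 'b) set) monoid"
  let ?\<Phi> = "hw_restrict Y y :: (real^('n option) \<Rightarrow> 'b) set \<Rightarrow> _"
  have carG: "carrier ?G = hw_class Y y ` hw_maps Y y" by (simp add: hawaiian_group_def)
  have carE: "\<exists>f\<in>hw_maps Y y. A = hw_class Y y f" if "A \<in> carrier ?G" for A
    using that unfolding carG image_iff .
  have into: "?\<Phi> A \<in> carrier ?L" if A: "A \<in> carrier ?G" for A
  proof -
    obtain f where f: "f \<in> hw_maps Y y" "A = hw_class Y y f" using carE[OF A] by blast
    have pi: "f \<circ> sk_param (Suc i) \<in> pi_maps Y y" for i using f(1) by (rule hw_maps_sk_param) simp
    then have "f \<circ> sk_param (Suc i) \<in> pi_class Y y (f \<circ> sk_param (Suc i))" for i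
      unfolding mem_pi_class_iff by (rule cube_homotopic_refl)
    then have "\<exists>F. (\<forall>i. F i \<in> pi_class Y y (f \<circ> sk_param (Suc i))) \<and> null_convergent Y y F"
      using null_convergent_sk_param[OF f(1)] by (intro exI[of _ "\<lambda>i. f \<circ> sk_param (Suc i)"]) simp
    then show ?thesis
      unfolding f(2) hw_restrict_hw_class[OF f(1)] L_group_def homotopy_group_def
      using pi by simp
  qed
  have "?\<Phi> (A \<otimes>\<^bsub>?G\<^esub> B) = ?\<Phi> A \<otimes>\<^bsub>?L\<^esub> ?\<Phi> B"
    if AB: "A \<in> carrier ?G" "B \<in> carrier ?G" for A B
  proof -
    \<comment> \<open>The product on the earring group and \<open>hw_restrict\<close> choose the
      same representatives, so both sides are expressed through the same \<open>f\<close> and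
      \<open>g\<close>.\<close>
    define f where "f = (SOME f. f \<in> A)"
    define g where "g = (SOME g. g \<in> B)"
    have "(SOME f. f \<in> C) \<in> hw_maps Y y" if C: "C \<in> carrier ?G" for C
    proof -
      obtain h where h: "h \<in> hw_maps Y y" "C = hw_class Y y h" using carE[OF C] by blast
      show ?thesis unfolding h(2) by (rule hw_homotopic_imp_hw_maps(2)[OF hw_class_SOME[OF h(1)]])
    qed
    then have fg: "f \<in> hw_maps Y y" "g \<in> hw_maps Y y" using AB by (auto simp: f_def g_def)
    have "A \<otimes>\<^bsub>?G\<^esub> B = hw_class Y y (hw_concat y f g)"
      by (simp add: hawaiian_group_def f_def g_def)
    then have "?\<Phi> (A \<otimes>\<^bsub>?G\<^esub> B) = (\<lambda>i. pi_class Y y (hw_concat y f g \<circ> sk_param (Suc i)))"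
      using hw_restrict_hw_class[OF hw_concat_hw_maps[OF fg]] by simp
    also have "\<dots> = (\<lambda>i. pi_class Y y (cube_concat (f \<circ> sk_param (Suc i)) (g \<circ> sk_param (Suc i))))"
    proof
      fix i
      have pi: "hw_concat y f g \<circ> sk_param (Suc i) \<in> pi_maps Y y"
        using hw_concat_hw_maps[OF fg] by (rule hw_maps_sk_param) simp
      then have "cube_homotopic Y y (hw_concat y f g \<circ> sk_param (Suc i))
                   (cube_concat (f \<circ> sk_param (Suc i)) (g \<circ> sk_param (Suc i)))"
        by (rule cube_homotopic_eq) (simp add: hw_concat_sk_param[OF fg])
      then show "pi_class Y y (hw_concat y f g \<circ> sk_param (Suc i)) =
          pi_class Y y (cube_concat (f \<circ> sk_param (Suc i)) (g \<circ> sk_param (Suc i)))"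
        by (rule pi_class_eq_iff[OF pi, THEN iffD2])
    qed
    also have "\<dots> = ?\<Phi> A \<otimes>\<^bsub>?L\<^esub> ?\<Phi> B"
      unfolding L_group_def hw_restrict_def f_def[symmetric] g_def[symmetric]
      using fg by (simp add: homotopy_group_mult hw_maps_sk_param)
    finally show ?thesis .
  qed
  moreover have "inj_on ?\<Phi> (carrier ?G)"
  proof (rule inj_onI)
    fix A B assume AB: "A \<in> carrier ?G" "B \<in> carrier ?G" and eq: "?\<Phi> A = ?\<Phi> B"
    obtain f where f: "f \<in> hw_maps Y y" "A = hw_class Y y f" using carE[OF AB(1)] by blast
    obtain g where g: "g \<in> hw_maps Y y" "B = hw_class Y y g" using carE[OF AB(2)] by blast
    have cube: "cube_homotopic Y y (f \<circ> sk_param k) (g \<circ> sk_param k :: real^'n \<Rightarrow> 'b)" if k: "k \<ge> 1" for k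
    proof -
      have "?\<Phi> A (k - 1) = ?\<Phi> B (k - 1)" using eq by simp
      then have "pi_class Y y (f \<circ> sk_param k) = pi_class Y y (g \<circ> sk_param k :: real^'n \<Rightarrow> 'b)"
        using k unfolding f(2) g(2) hw_restrict_hw_class[OF f(1)] hw_restrict_hw_class[OF g(1)] by simp
      then show ?thesis
        by (rule pi_class_eq_iff[OF hw_maps_sk_param[OF f(1) k], THEN iffD1])
    qed
    have "hw_homotopic Y y f g"
      by (rule hw_homotopic_if_cube_homotopic[OF V W r hom f(1) g(1) cube])
    then show "A = B" unfolding f(2) g(2) by (rule hw_class_eqI)
  qed
  moreover have "carrier ?L \<subseteq> ?\<Phi> ` carrier ?G"
  proof
    fix s assume "s \<in> carrier ?L"
    then obtain F where F: "\<And>i. F i \<in> pi_maps Y y" "\<And>i. s i = pi_class Y y (F i)" "null_convergent Y y F"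
      by (rule L_group_carrierE) blast
    \<comment> \<open>Sphere \<open>k\<close> carries the entry \<open>k - 1\<close>, inverse to the
      shift in \<open>hw_restrict\<close>.\<close>
    define f where "f = hw_glue y (\<lambda>k. F (k - 1))"
    have f: "f \<in> hw_maps Y y"
      unfolding f_def using F(1,3) by (rule null_convergent_imp_hw_map)
    have "pi_class Y y (f \<circ> sk_param (Suc i)) = s i" for i
    proof -
      have pi: "f \<circ> sk_param (Suc i) \<in> pi_maps Y y" using f by (rule hw_maps_sk_param) simp
      have "f (sk_param (Suc i) t) = F i t" if "t \<in> cbox 0 1" for t
        unfolding f_def using that F(1) by (subst hw_glue_sk_param) (auto simp: pi_maps_def)
      then have "cube_homotopic Y y (f \<circ> sk_param (Suc i)) (F i)"
        by (intro cube_homotopic_eq[OF pi]) simp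
      then show ?thesis unfolding F(2) by (rule pi_class_eq_iff[OF pi, THEN iffD2])
    qed
    then have "s = ?\<Phi> (hw_class Y y f)"
      unfolding hw_restrict_hw_class[OF f] by (intro ext) simp
    moreover have "hw_class Y y f \<in> carrier ?G" unfolding carG using f by (rule imageI)
    ultimately show "s \<in> ?\<Phi> ` carrier ?G" by (rule image_eqI)
  qed
  ultimately have "?\<Phi> \<in> iso ?G ?L"
    using into by (auto simp: iso_def hom_def bij_betw_def)
  then show ?thesis by (auto simp: is_iso_def)
qed

theorem theorem2p9:
  fixes X :: "nat \<Rightarrow> 'a topology" and x :: "nat \<Rightarrow> 'a"
  assumes "\<And>i. x i \<in> topspace (X i)"
    and "\<And>i. loc_strongly_contractible (X i) (x i)"
    and "\<And>i. first_countable_at (X i) (x i)"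
  shows "(hawaiian_group (weak_join X x) None :: ((real^('n::finite option) \<Rightarrow> _) set) monoid)
           \<cong> (L_group (weak_join X x) None :: (nat \<Rightarrow> (real^'n \<Rightarrow> _) set) monoid)"
  by (rule weak_join_local_retractions[OF assms]) (rule hawaiian_group_iso_L_group)

end
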